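(* Let $\mathcal{H}$ be a separable infinite-dimensional complex Hilbert space and let $\mathcal{L}$ be an infinite-dimensional, nonabelian Lie algebra of compact operators on $\mathcal{H}$. If $\mathcal{L}$ is a Lie algebra of compact quasinilpotent operators such that there exists $T\in\mathcal{L}$ whose singular number sequence $s(T)=\langle s_n(T)\rangle_{n\ge 1}$ satisfies the $\Delta_2$-condition, then $\mathcal{L}$ is not simple. In particular, if $\mathcal{L}$ consists of all compact weighted shift operators, then $\mathcal{L}$ is not simple.
   Context: A Lie algebra of compact operators is a linear subspace $\mathcal{L}$ of the compact operators on $\mathcal{H}$ that is closed under the commutator $[A,B]=AB-BA$. It is a Lie algebra of compact quasinilpotent operators if moreover every element of it is quasinilpotent (has spectrum $\{0\}$). It is nonabelian if $[A,B]\neq 0$ for some $A,B\in\mathcal{L}$. A Lie ideal of $\mathcal{L}$ is a Lie subalgebra $\mathcal{J}\subset\mathcal{L}$ with $[A,B]\in\mathcal{J}$ whenever $A\in\mathcal{L}$ and $B\in\mathcal{J}$ (no topological closedness is required). $\mathcal{L}$ is simple if its only Lie ideals are $\{0\}$ and $\mathcal{L}$. The singular numbers $s_1(T)\ge s_2(T)\ge\cdots$ of a compact operator $T$ are the eigenvalues of $|T|=(T^*T)^{1/2}$ in decreasing order, repeated according to multiplicity (followed by zeros if $T$ has finite rank). A nonincreasing sequence $\langle \xi_n\rangle_{n\ge1}$ of nonnegative numbers tending to $0$ satisfies the $\Delta_2$-condition if $\sup_{n}\xi_n/\xi_{2n}<\infty$, where it is understood that all $\xi_n>0$ so that the ratios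 are defined. A weighted shift operator with weight sequence $\langle w_n\rangle_{n\ge1}$ is an operator $T$ with $Te_n=w_ne_{n+1}$ for all $n\ge 1$, where $\{e_n\}_{n\ge1}$ is an orthonormal basis of $\mathcal{H}$; it is compact exactly when $w_n\to 0$.
   Formalization: The compact weighted shift operators do not form a Lie algebra (a commutator of two sends e_n to a multiple of e_{n+2}), so the last sentence is stated for the Lie algebra generated by all compact weighted shift operators along a fixed, arbitrary orthonormal basis. *)

theory Defs
  imports "HOL-Analysis.Analysis"
begin

class complex_vector = real_vector +
  fixes scaleC :: "complex \<Rightarrow> 'a \<Rightarrow> 'a" (infixr "*\<^sub>C" 75)
  assumes scaleC_add_right: "a *\<^sub>C (x + y) = a *\<^sub>C x + a *\<^sub>C y"
    and scaleC_add_left: "(a + b) *\<^sub>C x = a *\<^sub>C x + b *\<^sub>C x"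
    and scaleC_scaleC: "a *\<^sub>C (b *\<^sub>C x) = (a * b) *\<^sub>C x"
    and scaleC_one: "1 *\<^sub>C x = x"
    and scaleR_scaleC: "r *\<^sub>R x = complex_of_real r *\<^sub>C x"

global_interpretation cvec: vector_space "scaleC :: complex \<Rightarrow> 'a \<Rightarrow> 'a::complex_vector"
  by unfold_locales (simp_all add: scaleC_add_right scaleC_add_left scaleC_scaleC scaleC_one)

definition infinite_cdim :: "'a::complex_vector set \<Rightarrow> bool" where
  "infinite_cdim V \<longleftrightarrow> \<not> (\<exists>B. finite B \<and> V \<subseteq> cvec.span B)"

text \<open>The inner product is linear in its second argument.\<close>

class complex_hilbert = complex_vector + banach +
  fixes cinner :: "'a \<Rightarrow> 'a \<Rightarrow> complex"
  assumes cinner_commute: "cinner x y = cnj (cinner y x)"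
    and cinner_add_right: "cinner x (y + z) = cinner x y + cinner x z"
    and cinner_scaleC_right: "cinner x (c *\<^sub>C y) = c * cinner x y"
    and cinner_self: "cinner x x = complex_of_real ((norm x)\<^sup>2)"

lemma norm_scaleC: "norm (c *\<^sub>C x) = cmod c * norm (x :: 'a::complex_hilbert)"
proof -
  have "cinner (c *\<^sub>C x) (c *\<^sub>C x) = c * cnj (c * cinner x x)"
    by (metis cinner_commute cinner_scaleC_right)
  also have "\<dots> = complex_of_real ((cmod c * norm x)\<^sup>2)"
    by (simp add: cinner_self power_mult_distrib mult.assoc[symmetric] complex_norm_square[symmetric])
  finally have "(norm (c *\<^sub>C x))\<^sup>2 = (cmod c * norm x)\<^sup>2"
    unfolding cinner_self of_real_eq_iff .
  then show ?thesis
    by simp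
qed

lemma bounded_linear_scaleC: "bounded_linear (\<lambda>x :: 'a::complex_hilbert. c *\<^sub>C x)"
proof (rule bounded_linear_intro)
  show "c *\<^sub>C (x + y) = c *\<^sub>C x + c *\<^sub>C y" for x y :: 'a
    by (rule scaleC_add_right)
  show "c *\<^sub>C (r *\<^sub>R x) = r *\<^sub>R (c *\<^sub>C x)" for r and x :: 'a
    by (simp add: scaleR_scaleC scaleC_scaleC mult.commute)
  show "norm (c *\<^sub>C x) \<le> norm x * cmod c" for x :: 'a
    by (simp add: norm_scaleC mult.commute)
qed

instantiation blinfun :: (real_normed_vector, complex_hilbert) complex_vector
begin

lift_definition scaleC_blinfun :: "complex \<Rightarrow> 'a \<Rightarrow>\<^sub>L 'b \<Rightarrow> 'a \<Rightarrow>\<^sub>L 'b" is "\<lambda>c A x. c *\<^sub>C A x"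
  by (rule bounded_linear_compose[OF bounded_linear_scaleC])

instance
  by standard (transfer; simp add: fun_eq_iff scaleC_add_right scaleC_add_left scaleC_scaleC
      scaleC_one scaleR_scaleC)+

end

text \<open>The type of bounded linear functions only records real linearity, so complex linearity is
  a separate predicate.\<close>

definition clinear_op :: "('a::complex_hilbert \<Rightarrow>\<^sub>L 'a) \<Rightarrow> bool" where
  "clinear_op A \<longleftrightarrow> (\<forall>c x. A (c *\<^sub>C x) = c *\<^sub>C A x)"

definition compact_op :: "('a::complex_hilbert \<Rightarrow>\<^sub>L 'a) \<Rightarrow> bool" where
  "compact_op A \<longleftrightarrow> clinear_op A \<and> compact (closure (blinfun_apply A ` cball 0 1))"

definition spectrum_op :: "('a::complex_hilbert \<Rightarrow>\<^sub>L 'a) \<Rightarrow> complex set" where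
  "spectrum_op A = {c. \<not> (\<exists>B. clinear_op B \<and> B o\<^sub>L (A - c *\<^sub>C id_blinfun) = id_blinfun \<and>
                               (A - c *\<^sub>C id_blinfun) o\<^sub>L B = id_blinfun)}"

definition quasinilpotent_op :: "('a::complex_hilbert \<Rightarrow>\<^sub>L 'a) \<Rightarrow> bool" where
  "quasinilpotent_op A \<longleftrightarrow> spectrum_op A = {0}"

definition adjoint_op :: "('a::complex_hilbert \<Rightarrow>\<^sub>L 'a) \<Rightarrow> ('a \<Rightarrow>\<^sub>L 'a)" where
  "adjoint_op A = (THE B. clinear_op B \<and> (\<forall>x y. cinner (B x) y = cinner x (A y)))"

definition positive_op :: "('a::complex_hilbert \<Rightarrow>\<^sub>L 'a) \<Rightarrow> bool" where
  "positive_op A \<longleftrightarrow> clinear_op A \<and> (\<forall>x. cinner x (A x) \<in> \<real> \<and> 0 \<le> Re (cinner x (A x)))"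

definition abs_op :: "('a::complex_hilbert \<Rightarrow>\<^sub>L 'a) \<Rightarrow> ('a \<Rightarrow>\<^sub>L 'a)" where
  "abs_op A = (THE S. positive_op S \<and> S o\<^sub>L S = adjoint_op A o\<^sub>L A)"

definition eigenspace :: "('a::complex_hilbert \<Rightarrow>\<^sub>L 'a) \<Rightarrow> complex \<Rightarrow> 'a set" where
  "eigenspace A c = {x. A x = c *\<^sub>C x}"

text \<open>Sequences are indexed from 1 on, and the index 0 carries a dummy value. For compact
  \<open>T\<close>, the nonincreasing null sequence in which every positive number occurs as often as its
  multiplicity as an eigenvalue of \<open>|T|\<close> is unique. If \<open>T\<close> has finite rank, these
  requirements force the remaining terms to be zero; otherwise all terms are positive.\<close>

definition singular_numbers :: "('a::complex_hilbert \<Rightarrow>\<^sub>L 'a) \<Rightarrow> nat \<Rightarrow> real" where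
  "singular_numbers T = (THE s. s 0 = 0 \<and> antimono_on {1..} s \<and> s \<longlonglongrightarrow> 0 \<and>
     (\<forall>r>0. card {n\<in>{1..}. s n = r} = cvec.dim (eigenspace (abs_op T) (complex_of_real r))))"

definition Delta2 :: "(nat \<Rightarrow> real) \<Rightarrow> bool" where
  "Delta2 \<xi> \<longleftrightarrow> (\<forall>n\<ge>1. 0 < \<xi> n) \<and> bdd_above ((\<lambda>n. \<xi> n / \<xi> (2 * n)) ` {1..})"

definition commutator :: "('a::complex_hilbert \<Rightarrow>\<^sub>L 'a) \<Rightarrow> ('a \<Rightarrow>\<^sub>L 'a) \<Rightarrow> ('a \<Rightarrow>\<^sub>L 'a)" where
  "commutator A B = (A o\<^sub>L B) - (B o\<^sub>L A)"

definition lie_algebra :: "('a::complex_hilbert \<Rightarrow>\<^sub>L 'a) set \<Rightarrow> bool" where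
  "lie_algebra L \<longleftrightarrow> cvec.subspace L \<and> (\<forall>A\<in>L. \<forall>B\<in>L. commutator A B \<in> L)"

definition lie_algebra_compact :: "('a::complex_hilbert \<Rightarrow>\<^sub>L 'a) set \<Rightarrow> bool" where
  "lie_algebra_compact L \<longleftrightarrow> lie_algebra L \<and> (\<forall>A\<in>L. compact_op A)"

definition nonabelian :: "('a::complex_hilbert \<Rightarrow>\<^sub>L 'a) set \<Rightarrow> bool" where
  "nonabelian L \<longleftrightarrow> (\<exists>A\<in>L. \<exists>B\<in>L. commutator A B \<noteq> 0)"

definition lie_ideal :: "('a::complex_hilbert \<Rightarrow>\<^sub>L 'a) set \<Rightarrow> ('a \<Rightarrow>\<^sub>L 'a) set \<Rightarrow> bool" where
  "lie_ideal J L \<longleftrightarrow> lie_algebra J \<and> J \<subseteq> L \<and> (\<forall>A\<in>L. \<forall>B\<in>J. commutator A B \<in> J)"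

definition lie_simple :: "('a::complex_hilbert \<Rightarrow>\<^sub>L 'a) set \<Rightarrow> bool" where
  "lie_simple L \<longleftrightarrow> (\<forall>J. lie_ideal J L \<longrightarrow> J = {0} \<or> J = L)"

definition orthonormal_basis :: "(nat \<Rightarrow> 'a::complex_hilbert) \<Rightarrow> bool" where
  "orthonormal_basis e \<longleftrightarrow>
     (\<forall>m\<ge>1. \<forall>n\<ge>1. cinner (e m) (e n) = (if m = n then 1 else 0)) \<and>
     closure (cvec.span (e ` {1..})) = UNIV"

definition weighted_shift :: "(nat \<Rightarrow> 'a::complex_hilbert) \<Rightarrow> ('a \<Rightarrow>\<^sub>L 'a) \<Rightarrow> bool" where
  "weighted_shift e T \<longleftrightarrow> clinear_op T \<and>
     (\<exists>w :: nat \<Rightarrow> complex. \<forall>n\<ge>1. T (e n) = w n *\<^sub>C e (n + 1))"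

text \<open>The compact weighted shifts along a fixed orthonormal basis are not closed under
  commutators (the commutator of two of them moves \<open>e n\<close> to a multiple of
  \<open>e (n + 2)\<close>). The Lie algebra given by all of them is the one they generate.\<close>

definition lie_generated :: "('a::complex_hilbert \<Rightarrow>\<^sub>L 'a) set \<Rightarrow> ('a \<Rightarrow>\<^sub>L 'a) set" where
  "lie_generated S = \<Inter>{M. lie_algebra M \<and> S \<subseteq> M}"

lemma lie_generated_eq_self: "lie_algebra S \<Longrightarrow> lie_generated S = S"
  by (auto simp: lie_generated_def)

definition weighted_shift_lie_algebra ::
    "(nat \<Rightarrow> 'a::complex_hilbert) \<Rightarrow> ('a \<Rightarrow>\<^sub>L 'a) set" where
  "weighted_shift_lie_algebra e = lie_generated {T. compact_op T \<and> weighted_shift e T}"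

end

theory Submission
  imports Defs
begin

text \<open>Let \<open>T\<close> have singular numbers \<open>\<sigma>\<close> satisfying the \<open>\<Delta>\<^sub>2\<close>-condition. Intersecting \<open>L\<close> with an operator
  ideal gives a Lie ideal of \<open>L\<close>. The ideal of operators whose singular numbers are dominated by an
  ampliation of \<open>\<sigma>\<close> contains \<open>T\<close>, so if \<open>L\<close> is simple, it contains \<open>L\<close>. All commutators then lie in
  the ideal belonging to \<open>\<sigma>\<^sup>2\<close>, and since some commutator is nonzero, that ideal contains \<open>L\<close> as well,
  in particular \<open>T\<close>: \<open>\<sigma> (k * n) \<le> C * (\<sigma> n)\<^sup>2\<close> for all \<open>n\<close>. By \<open>\<Delta>\<^sub>2\<close> the left-hand side is at
  least a fixed multiple of \<open>\<sigma> n\<close>, which contradicts \<open>\<sigma> \<longlonglongrightarrow> 0\<close>.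

  For weighted shifts, the members of the generated Lie algebra that map each space
  \<open>{e 1, \<dots>, e n}\<^sup>\<bottom>\<close> into \<open>{e 1, \<dots>, e (n + 2)}\<^sup>\<bottom>\<close> form a proper Lie ideal that contains all
  commutators.\<close>

subsection \<open>Inner products\<close>

lemma cinner_add_left: "cinner (x + y) z = cinner x z + cinner y z"
  by (metis cinner_add_right cinner_commute complex_cnj_add)

lemma cinner_scaleC_left: "cinner (c *\<^sub>C x) y = cnj c * cinner x y"
  by (metis cinner_commute cinner_scaleC_right complex_cnj_mult)

lemma cinner_self_re: "Re (cinner x x) = (norm x)\<^sup>2"
  by (simp add: cinner_self)

lemma norm_add_sq: "(norm (x + y))\<^sup>2 = (norm x)\<^sup>2 + 2 * Re (cinner x y) + (norm y)\<^sup>2"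
proof -
  have "Re (cinner y x) = Re (cinner x y)"
    by (subst cinner_commute) simp
  then show ?thesis
    by (simp add: cinner_self_re[symmetric] cinner_add_left cinner_add_right)
qed

text \<open>Cauchy-Schwarz. With the chosen \<open>c\<close>, the vector
  \<open>y + c *\<^sub>C x\<close> is the component of \<open>y\<close> orthogonal to
  \<open>x\<close>, and its squared norm, which is nonnegative, expands to the claim.\<close>

lemma cmod_cinner_le: "cmod (cinner x y) \<le> norm x * norm y"
proof (cases "x = 0")
  case True
  then show ?thesis
    by (metis cinner_scaleC_left complex_cnj_zero cvec.scale_zero_left mult_zero_left norm_zero order_refl)
next
  case False
  define a where "a = cinner x y"
  define c where "c = - a / (norm x)\<^sup>2"
  have nx: "norm x > 0"
    using False by simp
  have yx: "cinner y (c *\<^sub>C x) = c * cnj a"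
    by (metis a_def cinner_commute cinner_scaleC_right)
  have "0 \<le> (norm (y + c *\<^sub>C x))\<^sup>2"
    by simp
  also have "\<dots> = (norm y)\<^sup>2 + 2 * Re (c * cnj a) + (cmod c)\<^sup>2 * (norm x)\<^sup>2"
    by (simp add: norm_add_sq norm_scaleC yx power_mult_distrib)
  also have "c * cnj a = - complex_of_real ((cmod a)\<^sup>2 / (norm x)\<^sup>2)"
    by (simp add: c_def complex_norm_square del: of_real_power)
  also have "(cmod c)\<^sup>2 * (norm x)\<^sup>2 = (cmod a)\<^sup>2 / (norm x)\<^sup>2"
    using nx by (simp add: c_def norm_divide power_divide field_simps norm_power)
  finally have "(cmod a)\<^sup>2 / (norm x)\<^sup>2 \<le> (norm y)\<^sup>2"
    by simp
  then have "(cmod a)\<^sup>2 \<le> (norm x * norm y)\<^sup>2"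
    using nx by (simp add: field_simps power_mult_distrib)
  then show ?thesis
    unfolding a_def by (rule power2_le_imp_le) simp
qed

global_interpretation cinner: bounded_bilinear "cinner :: 'a::complex_hilbert \<Rightarrow> 'a \<Rightarrow> complex"
proof
  show "\<exists>K. \<forall>a b :: 'a. cmod (cinner a b) \<le> norm a * norm b * K"
    by (rule exI[of _ 1]) (simp add: cmod_cinner_le)
qed (simp_all add: cinner_add_left cinner_add_right scaleR_scaleC cinner_scaleC_left
    cinner_scaleC_right scaleR_conv_of_real)

lemma bounded_bilinear_scaleC:
  "bounded_bilinear (scaleC :: complex \<Rightarrow> 'a \<Rightarrow> 'a::complex_hilbert)"
proof
  show "\<exists>K. \<forall>c (x :: 'a). norm (c *\<^sub>C x) \<le> cmod c * norm x * K"
    by (rule exI[of _ 1]) (simp add: norm_scaleC)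
qed (simp_all add: scaleC_add_left scaleC_add_right scaleR_scaleC scaleC_scaleC
    scaleR_conv_of_real mult.commute)

lemma cinner_ext:
  assumes "\<And>z. cinner z x = cinner z y"
  shows "x = y"
proof -
  have "cinner (x - y) (x - y) = 0"
    using assms[of "x - y"] by (simp add: cinner.diff_right)
  then show ?thesis
    by (simp add: cinner_self)
qed

lemma norm_add_sq_orthogonal:
  "cinner x y = 0 \<Longrightarrow> (norm (x + y))\<^sup>2 = (norm x)\<^sup>2 + (norm y)\<^sup>2"
  by (simp add: norm_add_sq)

lemma norm_sum_sq_orthogonal:
  assumes "finite I" and "\<And>i j. i \<in> I \<Longrightarrow> j \<in> I \<Longrightarrow> i \<noteq> j \<Longrightarrow> cinner (u i) (u j) = 0"
  shows "(norm (\<Sum>i\<in>I. u i))\<^sup>2 = (\<Sum>i\<in>I. (norm (u i))\<^sup>2)"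
  using assms
proof (induction I)
  case (insert k I)
  have "cinner (u k) (\<Sum>i\<in>I. u i) = 0"
    unfolding cinner.sum_right using insert by (intro sum.neutral) auto
  then show ?case
    using insert by (simp add: norm_add_sq_orthogonal)
qed simp

text \<open>Bessel for an orthogonal family that is not normalized and may contain zeros. The
  left-hand side \<open>Q\<close> equals \<open>cinner y x\<close> for the vector \<open>y\<close>
  below, so \<open>Q \<le> norm y * norm x\<close>. Orthogonality gives that the square of
  \<open>norm y\<close> is at most \<open>b\<^sup>2 * Q\<close>, and one factor \<open>Q\<close>
  cancels.\<close>

lemma bessel_inequality:
  fixes u :: "'i \<Rightarrow> 'a::complex_hilbert"
  assumes "finite I" and orth: "\<And>i j. i \<in> I \<Longrightarrow> j \<in> I \<Longrightarrow> i \<noteq> j \<Longrightarrow> cinner (u i) (u j) = 0"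
    and le: "\<And>i. i \<in> I \<Longrightarrow> norm (u i) \<le> b"
  shows "(\<Sum>i\<in>I. (cmod (cinner (u i) x))\<^sup>2) \<le> b\<^sup>2 * (norm x)\<^sup>2"
proof -
  define Q where "Q = (\<Sum>i\<in>I. (cmod (cinner (u i) x))\<^sup>2)"
  define y where "y = (\<Sum>i\<in>I. cinner (u i) x *\<^sub>C u i)"
  have Q0: "Q \<ge> 0"
    by (simp add: Q_def sum_nonneg)
  have "cinner y x = (\<Sum>i\<in>I. complex_of_real ((cmod (cinner (u i) x))\<^sup>2))"
    unfolding y_def cinner.sum_left cinner_scaleC_left complex_norm_square by (simp add: mult.commute)
  then have "Q = cmod (cinner y x)"
    using Q0 by (simp add: Q_def flip: of_real_sum of_real_power)
  then have 1: "Q \<le> norm y * norm x"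
    using cmod_cinner_le[of y x] by simp
  have "(norm y)\<^sup>2 = (\<Sum>i\<in>I. (norm (cinner (u i) x *\<^sub>C u i))\<^sup>2)"
    unfolding y_def using assms
    by (intro norm_sum_sq_orthogonal) (auto simp: cinner_scaleC_left cinner_scaleC_right)
  also have "\<dots> \<le> (\<Sum>i\<in>I. (cmod (cinner (u i) x))\<^sup>2 * b\<^sup>2)"
    using le by (intro sum_mono) (auto simp: norm_scaleC power_mult_distrib intro!: mult_left_mono power_mono)
  also have "\<dots> = b\<^sup>2 * Q"
    by (simp add: Q_def sum_distrib_left mult.commute)
  finally have 2: "(norm y)\<^sup>2 \<le> b\<^sup>2 * Q" .
  have "Q * Q \<le> (norm y * norm x)\<^sup>2"
    using 1 Q0 by (simp add: power2_eq_square mult_mono)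
  also have "\<dots> \<le> b\<^sup>2 * Q * (norm x)\<^sup>2"
    using 2 by (simp add: power_mult_distrib mult_right_mono)
  finally have "Q * Q \<le> Q * (b\<^sup>2 * (norm x)\<^sup>2)"
    by (simp add: mult_ac)
  then show ?thesis
    using Q0 unfolding Q_def[symmetric] by (cases "Q = 0") auto
qed

section \<open>Rank-one operators\<close>

lift_definition rank_one :: "'a::complex_hilbert \<Rightarrow> 'b::complex_hilbert \<Rightarrow> 'a \<Rightarrow>\<^sub>L 'b" is
  "\<lambda>u v x. cinner u x *\<^sub>C v"
  by (rule bounded_linear_compose[OF bounded_bilinear.bounded_linear_left[OF bounded_bilinear_scaleC]
        cinner.bounded_linear_right])

lemma clinear_op_rank_one: "clinear_op (rank_one u v)"
  by (simp add: clinear_op_def rank_one.rep_eq cinner_scaleC_right scaleC_scaleC)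

lemma clinear_op_sum: "(\<And>i. i \<in> I \<Longrightarrow> clinear_op (A i)) \<Longrightarrow> clinear_op (sum A I)"
  by (induction I rule: infinite_finite_induct)
    (simp_all add: clinear_op_def blinfun.add_left scaleC_add_right)

subsection \<open>Schmidt decomposition\<close>

lemma compact_op_subseq_tendsto:
  assumes "compact_op T" and "\<And>k. norm (x k) \<le> 1"
  obtains y r where "strict_mono (r :: nat \<Rightarrow> nat)" and "(\<lambda>k. T (x (r k))) \<longlonglongrightarrow> y"
proof -
  have "seq_compact (closure (blinfun_apply T ` cball 0 1))"
    using assms(1) by (simp add: compact_op_def compact_imp_seq_compact)
  moreover have "\<forall>k. T (x k) \<in> closure (blinfun_apply T ` cball 0 1)"
    using assms(2) by (intro allI subsetD[OF closure_subset]) auto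
  ultimately obtain y r where "strict_mono (r :: nat \<Rightarrow> nat)" "((\<lambda>k. T (x k)) \<circ> r) \<longlonglongrightarrow> y"
    by (rule seq_compactE)
  then show ?thesis
    by (intro that) (simp_all add: o_def)
qed

text \<open>A maximizing sequence \<open>v\<close> is Cauchy without any appeal to weak compactness: along a
  subsequence \<open>T (v k)\<close> converges, so \<open>norm (T (v k + v l))\<close> is almost \<open>2 * M\<close>, which forces
  \<open>norm (v k + v l)\<close> to be almost \<open>2\<close>, and the parallelogram law applies.\<close>

lemma max_vector_exists:
  fixes T :: "'a::complex_hilbert \<Rightarrow>\<^sub>L 'a"
  assumes T: "compact_op T" and W: "closed W" "cvec.subspace W" and ne: "\<exists>x\<in>W. x \<noteq> 0"
  shows "\<exists>e\<in>W. norm e = 1 \<and> (\<forall>x\<in>W. norm (T x) \<le> norm (T e) * norm x)"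
proof -
  let ?U = "{x\<in>W. norm x \<le> 1}"
  have scaleR_W: "r *\<^sub>R x \<in> W" if "x \<in> W" for r x
    using W(2) that by (simp add: scaleR_scaleC cvec.subspace_scale)
  define M where "M = (SUP x\<in>?U. norm (T x))"
  have bdd: "bdd_above ((\<lambda>x. norm (T x)) ` ?U)"
  proof (rule bdd_aboveI2)
    show "norm (T x) \<le> norm T * 1" if "x \<in> ?U" for x
      using that norm_blinfun[of T x] mult_left_mono[of "norm x" 1 "norm T"] by auto
  qed
  have le_M: "norm (T x) \<le> M" if "x \<in> ?U" for x
    unfolding M_def by (rule cSUP_upper[OF that bdd])
  have le_M': "norm (T x) \<le> M * norm x" if "x \<in> W" for x
  proof (cases "x = 0")
    case False
    then have "norm (T ((1 / norm x) *\<^sub>R x)) \<le> M"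
      using that by (intro le_M) (simp add: scaleR_W)
    then show ?thesis
      using False by (simp add: blinfun.scaleR_right field_simps)
  qed simp
  obtain z where z: "z \<in> W" "norm z = 1"
  proof -
    obtain x where x: "x \<in> W" "x \<noteq> 0"
      using ne by auto
    show ?thesis
      by (rule that[of "(1 / norm x) *\<^sub>R x"]) (use x in \<open>auto simp: scaleR_W\<close>)
  qed
  have M0: "M \<ge> 0"
    using order_trans[OF norm_ge_zero le_M[of z]] z by simp
  show ?thesis
  proof (cases "M = 0")
    case True
    then show ?thesis
      using z le_M' by (intro bexI[of _ z]) auto
  next
    case False
    then have M: "M > 0"
      using M0 by simp
    have "\<exists>x\<in>?U. M - 1 / real (Suc k) < norm (T x)" for k
      using z by (intro less_cSUP_iff[THEN iffD1, OF _ bdd, folded M_def]) auto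
    then have "\<forall>k. \<exists>x. x \<in> ?U \<and> M - 1 / real (Suc k) < norm (T x)"
      by blast
    from choice[OF this] obtain x where x: "\<And>k. x k \<in> ?U" "\<And>k. M - 1 / real (Suc k) < norm (T (x k))"
      by auto
    obtain y r where r: "strict_mono (r :: nat \<Rightarrow> nat)" and y: "(\<lambda>k. T (x (r k))) \<longlonglongrightarrow> y"
      using compact_op_subseq_tendsto[OF T, of x] x(1) by blast
    define v where "v = x \<circ> r"
    have v: "v k \<in> W" "norm (v k) \<le> 1" for k
      using x(1)[of "r k"] by (auto simp: v_def)
    have Tv: "(\<lambda>k. T (v k)) \<longlonglongrightarrow> y"
      using y by (simp add: v_def)
    have lim1: "(\<lambda>k. norm (T (x k))) \<longlonglongrightarrow> M"
    proof (rule real_tendsto_sandwich)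
      show "(\<lambda>k. M - 1 / real (Suc k)) \<longlonglongrightarrow> M"
        using tendsto_diff[OF tendsto_const[of M] LIMSEQ_inverse_real_of_nat]
        by (simp add: inverse_eq_divide)
      show "\<forall>\<^sub>F n in sequentially. M - 1 / real (Suc n) \<le> norm (T (x n))"
        using x(2) by (intro always_eventually) (auto intro: less_imp_le)
      show "\<forall>\<^sub>F n in sequentially. norm (T (x n)) \<le> M"
        using le_M x(1) by (intro always_eventually) auto
    qed simp
    have "(\<lambda>k. norm (T (v k))) \<longlonglongrightarrow> M"
      using LIMSEQ_subseq_LIMSEQ[OF lim1 r] by (simp add: v_def o_def)
    then have ny: "norm y = M"
      using tendsto_norm[OF Tv] LIMSEQ_unique by blast
    have "Cauchy v"
    proof (rule metric_CauchyI)
      fix \<epsilon> :: real assume \<epsilon>: "\<epsilon> > 0"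
      \<comment> \<open>In the parallelogram law the difference has squared norm below
        \<open>4 - (2 - 2 * \<delta>)\<^sup>2\<close>, which is at most \<open>8 * \<delta>\<close>.
        The bound \<open>\<delta> \<le> 1\<close> keeps \<open>2 - 2 * \<delta>\<close> nonnegative,
        so that the inequality may be squared.\<close>
      define \<delta> where "\<delta> = min 1 (\<epsilon>\<^sup>2 / 8)"
      have \<delta>: "\<delta> > 0" "\<delta> \<le> 1" "8 * \<delta> \<le> \<epsilon>\<^sup>2"
        using \<epsilon> by (auto simp: \<delta>_def min_def)
      obtain K where K: "\<And>k. k \<ge> K \<Longrightarrow> norm (T (v k) - y) < \<delta> * M"
        using LIMSEQ_D[OF Tv, of "\<delta> * M"] \<delta> M by auto
      have "dist (v k) (v l) < \<epsilon>" if kl: "k \<ge> K" "l \<ge> K" for k l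
      proof -
        have "2 * M = norm (2 *\<^sub>R y)"
          using ny by simp
        also have "2 *\<^sub>R y = T (v k + v l) - (T (v k) - y) - (T (v l) - y)"
          by (simp add: blinfun.add_right scaleR_2)
        also have "norm \<dots> \<le> norm (T (v k + v l)) + norm (T (v k) - y) + norm (T (v l) - y)"
          using norm_triangle_ineq4[of "T (v k + v l) - (T (v k) - y)" "T (v l) - y"]
            norm_triangle_ineq4[of "T (v k + v l)" "T (v k) - y"] by linarith
        also have "\<dots> < M * norm (v k + v l) + \<delta> * M + \<delta> * M"
          using K[OF kl(1)] K[OF kl(2)] le_M'[OF cvec.subspace_add[OF W(2) v(1) v(1)], of k l]
          by linarith
        finally have "M * 2 < M * (norm (v k + v l) + 2 * \<delta>)"
          by (simp add: algebra_simps)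
        then have "2 - 2 * \<delta> < norm (v k + v l)"
          using M by simp
        then have "(2 - 2 * \<delta>)\<^sup>2 < (norm (v k + v l))\<^sup>2"
          using \<delta> by (intro power_strict_mono) auto
        moreover have "(norm (v k + v l))\<^sup>2 + (norm (v k - v l))\<^sup>2 = 2 * (norm (v k))\<^sup>2 + 2 * (norm (v l))\<^sup>2"
          using norm_add_sq[of "v k" "v l"] norm_add_sq[of "v k" "- v l"]
          by (simp add: cinner.minus_right)
        moreover have "(norm (v k))\<^sup>2 \<le> 1" "(norm (v l))\<^sup>2 \<le> 1"
          using v by (simp_all add: power_le_one)
        moreover have "(2 - 2 * \<delta>)\<^sup>2 \<ge> 4 - 8 * \<delta>"
          by (simp add: power2_eq_square algebra_simps)
        ultimately have "(norm (v k - v l))\<^sup>2 < \<epsilon>\<^sup>2"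
          using \<delta> by linarith
        then show ?thesis
          using \<epsilon> by (simp add: dist_norm power2_less_imp_less)
      qed
      then show "\<exists>K. \<forall>m\<ge>K. \<forall>n\<ge>K. dist (v m) (v n) < \<epsilon>"
        by blast
    qed
    then obtain e where e: "v \<longlonglongrightarrow> e"
      using Cauchy_convergent convergent_def by blast
    have eW: "e \<in> W"
      using closed_sequentially[OF W(1) _ e] v by blast
    have e1: "norm e \<le> 1"
      using Lim_bounded[OF tendsto_norm[OF e]] v by blast
    have Te: "norm (T e) = M"
      using LIMSEQ_unique[OF Tv blinfun.tendsto[OF tendsto_const e]] ny by simp
    then have "1 \<le> norm e"
      using le_M'[OF eW] M by simp
    then show ?thesis
      using e1 eW Te le_M' by (intro bexI[of _ e]) auto
  qed
qed

text \<open>A first-order variation argument. If the inner product \<open>z\<close> were nonzero,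
  moving from \<open>e\<close> to \<open>e + c *\<^sub>C y\<close> with \<open>c = t * cnj z\<close>
  would raise the squared norm of the image to first order in \<open>t\<close>, whereas the squared
  norm of the argument grows only to second order. This contradicts maximality at
  \<open>e\<close>.\<close>

lemma cinner_image_max_vector:
  assumes T: "clinear_op T" and W: "cvec.subspace W" and e: "e \<in> W" "norm e = 1"
    and max: "\<And>x. x \<in> W \<Longrightarrow> norm (T x) \<le> norm (T e) * norm x"
    and y: "y \<in> W" "cinner e y = 0"
  shows "cinner (T e) (T y) = 0"
proof (rule ccontr)
  define z where "z = cinner (T e) (T y)"
  define K where "K = (norm (T e))\<^sup>2 * (norm y)\<^sup>2"
  assume "cinner (T e) (T y) \<noteq> 0"
  then have z: "(cmod z)\<^sup>2 > 0"
    by (simp add: z_def)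
  have K: "K \<ge> 0"
    by (simp add: K_def)
  \<comment> \<open>Small enough for the quadratic term to lose: the final inequality reduces to
    \<open>2 \<le> t * K\<close>.\<close>
  define t where "t = 1 / (K + 1)"
  have t: "t > 0" "t * K < 1"
    using K by (auto simp: t_def field_simps)
  define c where "c = complex_of_real t * cnj z"
  have c: "(cmod c)\<^sup>2 = t\<^sup>2 * (cmod z)\<^sup>2"
    by (simp add: c_def norm_mult power_mult_distrib)
  have "(norm (T (e + c *\<^sub>C y)))\<^sup>2 \<le> (norm (T e) * norm (e + c *\<^sub>C y))\<^sup>2"
    using max[of "e + c *\<^sub>C y"] e y W by (intro power_mono) (auto simp: cvec.subspace_add cvec.subspace_scale)
  also have "(norm (T e) * norm (e + c *\<^sub>C y))\<^sup>2 = (norm (T e))\<^sup>2 * (1 + (cmod c)\<^sup>2 * (norm y)\<^sup>2)"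
    using e y by (simp add: power_mult_distrib norm_add_sq_orthogonal cinner_scaleC_right norm_scaleC)
  also have "T (e + c *\<^sub>C y) = T e + c *\<^sub>C T y"
    using T by (simp add: clinear_op_def blinfun.add_right)
  also have "(norm (T e + c *\<^sub>C T y))\<^sup>2 \<ge> (norm (T e))\<^sup>2 + 2 * Re (c * z)"
    by (simp add: norm_add_sq cinner_scaleC_right z_def)
  also have "c * z = complex_of_real (t * (cmod z)\<^sup>2)"
    by (simp add: c_def complex_norm_square mult.commute del: of_real_power)
  finally have "2 * t * (cmod z)\<^sup>2 \<le> t\<^sup>2 * (cmod z)\<^sup>2 * K"
    by (simp add: c K_def algebra_simps)
  then have "t * (cmod z)\<^sup>2 * 2 \<le> t * (cmod z)\<^sup>2 * (t * K)"
    by (simp add: power2_eq_square mult_ac)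
  then show False
    using t z by (simp add: mult_le_cancel_left)
qed

section \<open>Orthogonal complements and orthonormal sequences\<close>

lemma subspace_orthogonal: "cvec.subspace {x :: 'a::complex_hilbert. \<forall>u\<in>U. cinner u x = 0}"
  by (auto simp: cvec.subspace_def cinner.zero_right cinner_add_right cinner_scaleC_right)

lemma closed_orthogonal: "closed {x :: 'a::complex_hilbert. \<forall>u\<in>U. cinner u x = 0}"
proof -
  have "{x :: 'a. \<forall>u\<in>U. cinner u x = 0} = (\<Inter>u\<in>U. {x. cinner u x = 0})"
    by auto
  also have "closed \<dots>"
    by (intro closed_INT ballI closed_Collect_eq cinner.continuous_on continuous_on_const continuous_on_id)
  finally show ?thesis .
qed

text \<open>The sequence starts at index 0 and need not be complete, since the singular vectors of
  an operator with a kernel may fail to span a dense subspace.\<close>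

locale orthonormal_seq =
  fixes e :: "nat \<Rightarrow> 'a::complex_hilbert"
  assumes cinner_e: "cinner (e m) (e n) = (if m = n then 1 else 0)"
begin

lemma norm_e: "norm (e n) = 1"
proof -
  have "(norm (e n))\<^sup>2 = 1\<^sup>2"
    by (simp add: cinner_self_re[symmetric] cinner_e)
  then show ?thesis
    by (rule power2_eq_imp_eq) simp_all
qed

definition proj :: "nat \<Rightarrow> 'a \<Rightarrow> 'a" where
  "proj N x = (\<Sum>i<N. cinner (e i) x *\<^sub>C e i)"

lemma cinner_e_sum:
  assumes "finite I"
  shows "cinner (e k) (\<Sum>i\<in>I. c i *\<^sub>C e i) = (if k \<in> I then c k else 0)"
proof -
  have "cinner (e k) (\<Sum>i\<in>I. c i *\<^sub>C e i) = (\<Sum>i\<in>I. if i = k then c i else 0)"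
    unfolding cinner.sum_right by (intro sum.cong) (auto simp: cinner_scaleC_right cinner_e)
  then show ?thesis
    using assms by (simp add: sum.delta)
qed

lemma cinner_e_minus_proj: "i < N \<Longrightarrow> cinner (e i) (x - proj N x) = 0"
  by (simp add: proj_def cinner.diff_right cinner_e_sum)

lemma norm_minus_proj_le: "norm (x - proj N x) \<le> norm x"
proof -
  have "cinner (proj N x) (x - proj N x) = 0"
    by (subst proj_def) (simp add: cinner.sum_left cinner_scaleC_left cinner_e_minus_proj)
  from norm_add_sq_orthogonal[OF this] show ?thesis
    by (intro power2_le_imp_le[OF _ norm_ge_zero]) simp
qed

text \<open>Both families are orthogonal, so the norm is governed by the largest term and not by the
  sum of the norms: the squared norm of the image of \<open>x\<close> is a sum of squared
  coefficients, to which Bessel applies.\<close>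

lemma norm_sum_e_le:
  assumes "finite I" and "\<And>i. i \<in> I \<Longrightarrow> norm (u i) \<le> b"
    and "\<And>i j. i \<in> I \<Longrightarrow> j \<in> I \<Longrightarrow> i \<noteq> j \<Longrightarrow> cinner (u i) (u j) = 0" and "b \<ge> 0"
  shows "norm (\<Sum>i\<in>I. rank_one (u i) (e i)) \<le> b"
proof (rule norm_blinfun_bound[OF \<open>b \<ge> 0\<close>])
  fix x
  have "(norm (\<Sum>i\<in>I. cinner (u i) x *\<^sub>C e i))\<^sup>2 = (\<Sum>i\<in>I. (norm (cinner (u i) x *\<^sub>C e i))\<^sup>2)"
    using assms(1) by (intro norm_sum_sq_orthogonal) (simp_all add: cinner_scaleC_left cinner_scaleC_right cinner_e)
  also have "\<dots> \<le> b\<^sup>2 * (norm x)\<^sup>2"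
    using bessel_inequality[of I u b x] assms by (simp add: norm_scaleC norm_e)
  finally have "(norm (\<Sum>i\<in>I. cinner (u i) x *\<^sub>C e i))\<^sup>2 \<le> (b * norm x)\<^sup>2"
    by (simp add: power_mult_distrib)
  then have "norm (\<Sum>i\<in>I. cinner (u i) x *\<^sub>C e i) \<le> b * norm x"
    by (rule power2_le_imp_le) (simp add: \<open>b \<ge> 0\<close>)
  then show "norm ((\<Sum>i\<in>I. rank_one (u i) (e i)) x) \<le> b * norm x"
    by (simp add: blinfun.sum_left rank_one.rep_eq)
qed

text \<open>By \<open>norm_sum_e_le\<close>, the block of terms from index \<open>M\<close> on has
  norm at most \<open>\<sigma> M\<close>, so the partial sums are Cauchy in operator norm. This
  constructs both the adjoint and the absolute value of an operator.\<close>

lemma rank_one_series: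
  assumes "\<And>i j. i \<noteq> j \<Longrightarrow> cinner (u i) (u j) = 0" and "\<And>i. norm (u i) \<le> \<sigma> i"
    and "antimono \<sigma>" and "\<sigma> \<longlonglongrightarrow> 0"
  obtains D where "clinear_op D" and "\<And>x. (\<lambda>N. \<Sum>i<N. cinner (u i) x *\<^sub>C e i) \<longlonglongrightarrow> D x"
proof -
  have \<sigma>0: "\<sigma> i \<ge> 0" for i
    using assms(2)[of i] norm_ge_zero order_trans by blast
  define S where "S N = (\<Sum>i<N. rank_one (u i) (e i))" for N
  have S_le: "norm (S N - S M) \<le> \<sigma> M" if "M \<le> N" for M N
  proof -
    have "S N - S M = (\<Sum>i\<in>{M..<N}. rank_one (u i) (e i))"
      unfolding S_def lessThan_atLeast0 using that by (simp add: sum_diff_nat_ivl)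
    also have "norm \<dots> \<le> \<sigma> M"
      using assms \<sigma>0 by (intro norm_sum_e_le) (auto intro: order_trans[OF assms(2)] antimonoD)
    finally show ?thesis .
  qed
  have "Cauchy S"
  proof (rule metric_CauchyI)
    fix \<epsilon> :: real assume "\<epsilon> > 0"
    then obtain K where K: "\<sigma> K < \<epsilon> / 2"
      using order_tendstoD(2)[OF assms(4), of "\<epsilon> / 2"] by (auto simp: eventually_sequentially)
    have "dist (S m) (S n) < \<epsilon>" if "m \<ge> K" "n \<ge> K" for m n
      using S_le[OF that(1)] S_le[OF that(2)] K dist_triangle_half_r[of "S K" "S m" \<epsilon> "S n"]
      by (simp add: dist_norm norm_minus_commute)
    then show "\<exists>K. \<forall>m\<ge>K. \<forall>n\<ge>K. dist (S m) (S n) < \<epsilon>"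
      by blast
  qed
  then obtain D where "S \<longlonglongrightarrow> D"
    using Cauchy_convergent convergent_def by blast
  then have lim: "(\<lambda>N. S N x) \<longlonglongrightarrow> D x" for x
    by (intro blinfun.tendsto tendsto_const)
  have "clinear_op D"
    unfolding clinear_op_def
  proof (intro allI LIMSEQ_unique)
    fix c x
    show "(\<lambda>N. S N (c *\<^sub>C x)) \<longlonglongrightarrow> D (c *\<^sub>C x)"
      by (rule lim)
    have "clinear_op (S N)" for N
      unfolding S_def by (intro clinear_op_sum clinear_op_rank_one)
    then have "S N (c *\<^sub>C x) = c *\<^sub>C S N x" for N
      by (simp add: clinear_op_def)
    then show "(\<lambda>N. S N (c *\<^sub>C x)) \<longlonglongrightarrow> c *\<^sub>C D x"
      by (simp add: bounded_bilinear.tendsto[OF bounded_bilinear_scaleC] lim)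
  qed
  moreover have "(\<lambda>N. \<Sum>i<N. cinner (u i) x *\<^sub>C e i) \<longlonglongrightarrow> D x" for x
    using lim[of x] by (simp add: S_def blinfun.sum_left rank_one.rep_eq)
  ultimately show ?thesis
    by (rule that)
qed

end

text \<open>The data of a Schmidt decomposition: \<open>e\<close> consists of right singular vectors
  and \<open>\<sigma> n\<close> is the singular number with index \<open>n + 1\<close>. The last
  assumption is a weak form of the eigenvector equation for the adjoint of \<open>T\<close> composed
  with \<open>T\<close>, which avoids presupposing an adjoint.\<close>

locale schmidt = orthonormal_seq e for e :: "nat \<Rightarrow> 'a::complex_hilbert" +
  fixes T :: "'a \<Rightarrow>\<^sub>L 'a" and \<sigma> :: "nat \<Rightarrow> real"
  assumes clinear_T: "clinear_op T"
    and norm_T_e: "norm (T (e n)) = \<sigma> n"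
    and antimono_sigma: "antimono \<sigma>"
    and sigma_tendsto: "\<sigma> \<longlonglongrightarrow> 0"
    and norm_T_le: "(\<And>i. i < n \<Longrightarrow> cinner (e i) x = 0) \<Longrightarrow> norm (T x) \<le> \<sigma> n * norm x"
    and cinner_T_e: "cinner (T (e n)) (T x) = (complex_of_real (\<sigma> n))\<^sup>2 * cinner (e n) x"

text \<open>Otherwise every vector would equal its projection to a finite-dimensional span.
  Orthonormality is assumed below \<open>n\<close> only, because the lemma serves the recursive
  construction of \<open>e\<close>.\<close>

lemma orthogonal_vector_exists:
  fixes n :: nat
  assumes "infinite_cdim (UNIV :: 'a::complex_hilbert set)"
    and orth: "\<And>i j. i < n \<Longrightarrow> j < n \<Longrightarrow> cinner (e i) (e j) = (if i = j then 1 else 0)"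
  shows "\<exists>x :: 'a. (\<forall>i<n. cinner (e i) x = 0) \<and> x \<noteq> 0"
proof (rule ccontr)
  assume none: "\<not> ?thesis"
  have "x \<in> cvec.span (e ` {..<n})" for x :: 'a
  proof -
    let ?p = "\<Sum>i<n. cinner (e i) x *\<^sub>C e i"
    have "cinner (e k) (x - ?p) = 0" if "k < n" for k
    proof -
      have "cinner (e k) ?p = (\<Sum>i<n. if k = i then cinner (e i) x else 0)"
        unfolding cinner.sum_right using that by (intro sum.cong) (auto simp: cinner_scaleC_right orth)
      also have "\<dots> = cinner (e k) x"
        using that by (subst sum.delta') auto
      finally show ?thesis
        by (simp add: cinner.diff_right)
    qed
    then have "x - ?p = 0"
      using none by blast
    then have "x = ?p"
      by simp
    also have "?p \<in> cvec.span (e ` {..<n})"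
      by (intro cvec.span_sum cvec.span_scale cvec.span_base) simp
    finally show ?thesis .
  qed
  then have "UNIV \<subseteq> cvec.span (e ` {..<n})"
    by blast
  then show False
    using assms(1) finite_imageI[OF finite_lessThan, of e n] unfolding infinite_cdim_def by metis
qed

text \<open>The vectors are chosen greedily: \<open>e n\<close> is a unit vector at which
  \<open>T\<close> attains its norm on the orthogonal complement \<open>W e n\<close> of its
  predecessors.\<close>

lemma schmidt_exists:
  fixes T :: "'a::complex_hilbert \<Rightarrow>\<^sub>L 'a"
  assumes T: "compact_op T" and inf: "infinite_cdim (UNIV :: 'a set)"
  obtains e where "schmidt e T (\<lambda>n. norm (T (e n)))"
proof -
  define W where "W e n = {x :: 'a. \<forall>u\<in>e ` {..<n}. cinner u x = 0}" for e and n :: nat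
  have mem_W: "x \<in> W e n \<longleftrightarrow> (\<forall>i<n. cinner (e i) x = 0)" for x e n
    by (auto simp: W_def)
  have W: "cvec.subspace (W e n)" "closed (W e n)" for e n
    unfolding W_def by (rule subspace_orthogonal closed_orthogonal)+
  have clin: "clinear_op T"
    using T by (simp add: compact_op_def)
  define P where
    "P e n r \<longleftrightarrow> r \<in> W e n \<and> norm r = 1 \<and> (\<forall>x\<in>W e n. norm (T x) \<le> norm (T r) * norm x)" for e n r
  \<comment> \<open>Stated for an arbitrary sequence and two indices, so that it also applies to an
    initial segment during the recursive choice.\<close>
  have orth: "cinner (e i) (e j) = (if i = j then 1 else 0)"
    if "P e i (e i)" "P e j (e j)" for e i j
  proof -
    have *: "cinner (e k) (e l) = 0" if "k < l" "P e l (e l)" for k l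
    proof -
      have "e l \<in> W e l"
        using that(2) by (simp only: P_def)
      then show ?thesis
        using that(1) by (simp only: mem_W)
    qed
    have n1: "norm (e i) = 1"
      using that(1) by (simp only: P_def)
    consider "i < j" | "i = j" | "j < i"
      by linarith
    then show ?thesis
    proof cases
      case 1
      then show ?thesis
        using *[OF 1 that(2)] by simp
    next
      case 2
      then show ?thesis
        using n1 by (simp add: cinner_self)
    next
      case 3
      then show ?thesis
        by (subst cinner_commute) (simp add: *[OF 3 that(1)])
    qed
  qed
  have "\<exists>e. \<forall>n. P e n (e n)"
  proof (rule dependent_wellorder_choice)
    show "P f x r = P g x r" if "\<And>y. y < x \<Longrightarrow> f y = g y" for r f g x
    proof -
      have "W f x = W g x"
        using that by (simp add: set_eq_iff mem_W)
      then show ?thesis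
        by (simp add: P_def)
    qed
    show "\<exists>r. P f n r" if "\<And>y. y < n \<Longrightarrow> P f y (f y)" for n f
    proof -
      have "\<exists>x. (\<forall>i<n. cinner (f i) x = 0) \<and> x \<noteq> 0"
        by (rule orthogonal_vector_exists[OF inf]) (intro orth that)
      then have "\<exists>x\<in>W f n. x \<noteq> 0"
        by (simp add: Bex_def mem_W)
      from max_vector_exists[OF T W(2,1) this] show ?thesis
        by (simp only: P_def Bex_def)
    qed
  qed
  then obtain e where "\<forall>n. P e n (e n)" ..
  then have e: "P e n (e n)" for n ..
  interpret orthonormal_seq e
    by unfold_locales (rule orth[OF e e])
  have le: "norm (T x) \<le> norm (T (e n)) * norm x" if "x \<in> W e n" for x n
    using e[of n] that by (simp add: P_def)
  have eW: "e n \<in> W e m" if "m \<le> n" for m n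
    using that by (auto simp: mem_W cinner_e)
  have zero: "cinner (T (e n)) (T y) = 0" if "cinner (e n) y = 0" "y \<in> W e n" for n y
    using cinner_image_max_vector[OF clin W(1) eW[OF order_refl] norm_e le that(2,1)] .
  have zero_le: "cinner (T (e n)) (T (e i)) = 0" if "n < i" for n i
    using that by (intro zero) (auto simp: cinner_e eW)
  have zero_neq: "cinner (T (e n)) (T (e i)) = 0" if "n \<noteq> i" for n i
  proof (cases "n < i")
    case False
    then have "cinner (T (e i)) (T (e n)) = 0"
      using that by (intro zero_le) auto
    then show ?thesis
      by (subst cinner_commute) simp
  qed (rule zero_le)
  \<comment> \<open>Membership in \<open>W e n\<close> is removed by splitting off
    \<open>proj n y\<close>, whose image is a combination of the vectors \<open>T (e i)\<close> with
    \<open>i < n\<close>, all orthogonal to \<open>T (e n)\<close>.\<close>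
  have zero': "cinner (T (e n)) (T y) = 0" if "cinner (e n) y = 0" for n y
  proof -
    have "y - proj n y \<in> W e n"
      by (auto simp: mem_W cinner_e_minus_proj)
    moreover have "cinner (e n) (y - proj n y) = 0"
      by (simp add: cinner.diff_right that proj_def cinner_e_sum)
    ultimately have "cinner (T (e n)) (T (y - proj n y)) = 0"
      by (intro zero)
    moreover have "cinner (T (e n)) (T (proj n y)) = 0"
      using clin by (simp add: proj_def blinfun.sum_right cinner.sum_right clinear_op_def
          cinner_scaleC_right zero_neq)
    ultimately show ?thesis
      by (simp add: blinfun.diff_right cinner.diff_right)
  qed
  have anti: "norm (T (e n)) \<le> norm (T (e m))" if "m \<le> n" for m n
    using le[OF eW[OF that]] by (simp add: norm_e)
  have "schmidt e T (\<lambda>n. norm (T (e n)))"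
  proof unfold_locales
    show "antimono (\<lambda>n. norm (T (e n)))"
      using anti by (auto intro: antimonoI)
    show "norm (T x) \<le> norm (T (e n)) * norm x" if "\<And>i. i < n \<Longrightarrow> cinner (e i) x = 0" for n x
      using that by (intro le) (simp add: mem_W)
    show "cinner (T (e n)) (T x) = (complex_of_real (norm (T (e n))))\<^sup>2 * cinner (e n) x" for n x
    proof -
      \<comment> \<open>The component of \<open>x\<close> along \<open>e n\<close> is removed; it
        alone contributes to the inner product.\<close>
      have "cinner (T (e n)) (T (x - cinner (e n) x *\<^sub>C e n)) = 0"
        by (intro zero') (simp add: cinner.diff_right cinner_scaleC_right cinner_e)
      then show ?thesis
        using clin by (simp add: clinear_op_def blinfun.diff_right cinner.diff_right cinner_scaleC_right
            cinner_self mult.commute)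
    qed
    show "(\<lambda>n. norm (T (e n))) \<longlonglongrightarrow> 0"
    proof (rule LIMSEQ_I)
      fix r :: real assume r: "r > 0"
      \<comment> \<open>Orthogonal images of norm at least \<open>r\<close> would stay at distance
        at least \<open>r\<close> from each other and have no convergent subsequence. By
        monotonicity a single small norm suffices.\<close>
      have "\<exists>n. norm (T (e n)) < r"
      proof (rule ccontr)
        assume "\<not> ?thesis"
        then have ge: "norm (T (e n)) \<ge> r" for n
          by (simp add: not_less)
        obtain y p where p: "strict_mono (p :: nat \<Rightarrow> nat)" and y: "(\<lambda>k. T (e (p k))) \<longlonglongrightarrow> y"
          by (rule compact_op_subseq_tendsto[OF T, of e, OF eq_refl[OF norm_e]])
        obtain K where K: "\<And>m n. m \<ge> K \<Longrightarrow> n \<ge> K \<Longrightarrow> norm (T (e (p m)) - T (e (p n))) < r"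
          using CauchyD[OF LIMSEQ_imp_Cauchy[OF y] r] by blast
        have "p K \<noteq> p (Suc K)"
          using p by (simp add: strict_mono_eq)
        then have "(norm (T (e (p K)) - T (e (p (Suc K)))))\<^sup>2
            = (norm (T (e (p K))))\<^sup>2 + (norm (T (e (p (Suc K)))))\<^sup>2"
          using norm_add_sq[of "T (e (p K))" "- T (e (p (Suc K)))"] zero_neq
          by (simp add: cinner.minus_right)
        moreover have "(norm (T (e (p K)) - T (e (p (Suc K)))))\<^sup>2 < r\<^sup>2"
          using K[of K "Suc K"] by (intro power_strict_mono) auto
        moreover have "(norm (T (e (p K))))\<^sup>2 \<ge> r\<^sup>2"
          using ge[of "p K"] r by (intro power_mono) auto
        ultimately show False
          using zero_le_power2[of "norm (T (e (p (Suc K))))"] by linarith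
      qed
      then show "\<exists>n0. \<forall>n\<ge>n0. norm (norm (T (e n)) - 0) < r"
        by (metis anti diff_zero real_norm_def abs_norm_cancel order.strict_trans1)
    qed
  qed (use clin in auto)
  then show ?thesis
    by (rule that)
qed

subsection \<open>Absolute value and singular numbers\<close>

text \<open>Polarization. The sesquilinear defect \<open>h\<close> vanishes on the diagonal, hence
  is antisymmetric; antisymmetry at \<open>x\<close> and \<open>\<i> *\<^sub>C y\<close> makes it
  symmetric as well, so it is zero.\<close>

lemma positive_op_self_adjoint:
  assumes "positive_op A"
  shows "cinner (A x) y = cinner x (A y)"
proof -
  have lin: "A (c *\<^sub>C x) = c *\<^sub>C A x" for c x
    using assms by (simp add: positive_op_def clinear_op_def)
  define h where "h x y = cinner x (A y) - cinner (A x) y" for x y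
  have h0: "h x x = 0" for x
  proof -
    have "cinner (A x) x = cnj (cinner x (A x))"
      by (rule cinner_commute)
    also have "\<dots> = cinner x (A x)"
      using assms by (simp add: positive_op_def Reals_cnj_iff)
    finally show ?thesis
      by (simp add: h_def)
  qed
  have anti: "h x y + h y x = 0" for x y
    using h0[of "x + y"] h0[of x] h0[of y]
    by (simp add: h_def blinfun.add_right cinner_add_left cinner_add_right algebra_simps)
  have "h x (\<i> *\<^sub>C y) = \<i> * h x y" "h (\<i> *\<^sub>C y) x = - \<i> * h y x"
    by (simp_all add: h_def lin cinner_scaleC_left cinner_scaleC_right algebra_simps)
  then have "\<i> * h x y - \<i> * h y x = 0"
    using anti[of x "\<i> *\<^sub>C y"] by simp
  then have "h x y = h y x"
    by simp
  then have "h x y = 0"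
    using anti[of x y] by simp
  then show ?thesis
    by (simp add: h_def)
qed

text \<open>Resolves the definite description by uniqueness; a suitable \<open>B\<close> is supplied
  by \<open>adjoint_exists\<close>.\<close>

lemma adjoint_op_eq:
  fixes A :: "'a::complex_hilbert \<Rightarrow>\<^sub>L 'a"
  assumes "clinear_op B" and "\<And>x y. cinner (B x) y = cinner x (A y)"
  shows "adjoint_op A = B"
  unfolding adjoint_op_def
proof (rule the_equality)
  fix B' assume B': "clinear_op B' \<and> (\<forall>x y. cinner (B' x) y = cinner x (A y))"
  show "B' = B"
  proof (rule blinfun_eqI, rule cinner_ext)
    fix x z
    have "cinner (B' x) z = cinner (B x) z"
      using B' assms(2) by simp
    then show "cinner z (B' x) = cinner z (B x)"
      by (metis cinner_commute)
  qed
qed (use assms in auto)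

text \<open>Applied in both directions, this is the uniqueness behind
  \<open>singular_numbers\<close>. If \<open>s' n < s n = r\<close>, then at least \<open>n\<close>
  terms of \<open>s\<close> but fewer than \<open>n\<close> terms of \<open>s'\<close> are at least
  \<open>r\<close>, although both counts are sums of the same level cardinalities.\<close>

lemma antimono_le_if_level_cards_eq:
  fixes s s' :: "nat \<Rightarrow> real"
  assumes s: "antimono_on {1..} s" "s \<longlonglongrightarrow> 0" and s': "antimono_on {1..} s'" "s' \<longlonglongrightarrow> 0"
    and card: "\<And>r. r > 0 \<Longrightarrow> card {n\<in>{1..}. s n = r} = card {n\<in>{1..}. s' n = r}"
    and n: "n \<ge> 1"
  shows "s n \<le> s' n"
proof (rule ccontr)
  have fin: "finite {n\<in>{1..}. r \<le> t n}" if r: "r > 0" and t: "t \<longlonglongrightarrow> 0" for r and t :: "nat \<Rightarrow> real"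
  proof -
    obtain N where N: "\<And>n. n \<ge> N \<Longrightarrow> t n < r"
      using order_tendstoD(2)[OF t r] by (auto simp: eventually_sequentially)
    then have "{n\<in>{1..}. r \<le> t n} \<subseteq> {..<N}"
      by (metis (no_types, lifting) lessThan_iff mem_Collect_eq not_le subsetI)
    then show ?thesis
      using finite_subset by blast
  qed
  have nonneg: "t n \<ge> 0" if "n \<ge> 1" "antimono_on {1..} t" "t \<longlonglongrightarrow> 0" for n and t :: "nat \<Rightarrow> real"
  proof (rule LIMSEQ_le_const2[OF that(3)])
    show "\<exists>N. \<forall>k\<ge>N. t k \<le> t n"
      using that(1) monotone_onD[OF that(2), of n] by (intro exI[of _ n]) simp
  qed
  assume "\<not> s n \<le> s' n"
  then have less: "s' n < s n"
    by simp
  define r where "r = s n"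
  have r: "r > 0"
    using less nonneg[OF n s'] by (simp add: r_def)
  have levels: "card {n\<in>{1..}. r \<le> t n} = (\<Sum>q\<in>Q. card {n\<in>{1..}. t n = q})"
    if t: "t \<longlonglongrightarrow> 0" and Q: "finite Q" "t ` {n\<in>{1..}. r \<le> t n} \<subseteq> Q" "Q \<subseteq> {r..}"
    for Q and t :: "nat \<Rightarrow> real"
  proof -
    have "{n\<in>{1..}. r \<le> t n} = (\<Union>q\<in>Q. {n\<in>{1..}. t n = q})"
      using Q by fastforce
    also have "card \<dots> = (\<Sum>q\<in>Q. card {n\<in>{1..}. t n = q})"
    proof (rule card_UN_disjoint)
      show "\<forall>q\<in>Q. finite {n\<in>{1..}. t n = q}"
        using Q by (auto intro!: finite_subset[OF _ fin[OF r t]])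
    qed (use Q in auto)
    finally show ?thesis .
  qed
  \<comment> \<open>All values at least \<open>r\<close> of either sequence: one index set for both
    sums.\<close>
  define Q where "Q = s ` {n\<in>{1..}. r \<le> s n} \<union> s' ` {n\<in>{1..}. r \<le> s' n}"
  have Q: "finite Q" "Q \<subseteq> {r..}"
    using fin[OF r] s(2) s'(2) by (auto simp: Q_def)
  have "card {n\<in>{1..}. r \<le> s n} = (\<Sum>q\<in>Q. card {n\<in>{1..}. s n = q})"
    using s(2) Q by (intro levels) (auto simp: Q_def)
  also have "\<dots> = (\<Sum>q\<in>Q. card {n\<in>{1..}. s' n = q})"
    using Q r by (intro sum.cong refl card) auto
  also have "\<dots> = card {n\<in>{1..}. r \<le> s' n}"
    using s'(2) Q by (intro levels[symmetric]) (auto simp: Q_def)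
  also have "\<dots> \<le> card {1..<n}"
  proof (rule card_mono)
    show "{n\<in>{1..}. r \<le> s' n} \<subseteq> {1..<n}"
    proof
      fix m assume m: "m \<in> {n\<in>{1..}. r \<le> s' n}"
      have "m < n"
      proof (rule ccontr)
        assume "\<not> m < n"
        then have "s' m \<le> s' n"
          using monotone_onD[OF s'(1), of n m] n by simp
        then show False
          using m less by (simp add: r_def)
      qed
      then show "m \<in> {1..<n}"
        using m by simp
    qed
  qed simp
  also have "\<dots> < card {1..n}"
    using n by simp
  also have "\<dots> \<le> card {n\<in>{1..}. r \<le> s n}"
    using monotone_onD[OF s(1), of _ n] n by (intro card_mono fin r s(2)) (auto simp: r_def)
  finally show False
    by simp
qed

lemma (in orthonormal_seq) cinner_e_series:
  assumes "(\<lambda>N. \<Sum>i<N. c i *\<^sub>C e i) \<longlonglongrightarrow> y"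
  shows "cinner (e k) y = c k"
proof (rule LIMSEQ_unique)
  show "(\<lambda>N. cinner (e k) (\<Sum>i<N. c i *\<^sub>C e i)) \<longlonglongrightarrow> cinner (e k) y"
    by (intro cinner.tendsto assms tendsto_const)
  show "(\<lambda>N. cinner (e k) (\<Sum>i<N. c i *\<^sub>C e i)) \<longlonglongrightarrow> c k"
    by (rule tendsto_eventually, rule eventually_mono[OF eventually_gt_at_top[of k]])
      (simp add: cinner_e_sum)
qed

section \<open>Adjoint, absolute value and singular numbers from a Schmidt decomposition\<close>

context schmidt
begin

lemma T_scaleC: "T (c *\<^sub>C x) = c *\<^sub>C T x"
  using clinear_T by (simp add: clinear_op_def)

lemma sigma_nonneg: "\<sigma> n \<ge> 0"
  using norm_T_e[of n] norm_ge_zero[of "T (e n)"] by simp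

lemma T_e_orthogonal: "i \<noteq> j \<Longrightarrow> cinner (T (e i)) (T (e j)) = 0"
  by (simp add: cinner_T_e cinner_e)

lemma norm_T_minus_proj_le: "norm (T (x - proj N x)) \<le> \<sigma> N * norm x"
  by (rule order_trans[OF norm_T_le mult_left_mono[OF norm_minus_proj_le sigma_nonneg]])
    (rule cinner_e_minus_proj)

lemma T_minus_proj_tendsto: "(\<lambda>N. norm (T (x - proj N x))) \<longlonglongrightarrow> 0"
  by (rule Lim_null_comparison[OF _ tendsto_mult_left_zero[OF sigma_tendsto, of "norm x"]])
    (simp add: norm_T_minus_proj_le)

lemma T_proj_tendsto: "(\<lambda>N. T (proj N x)) \<longlonglongrightarrow> T x"
proof -
  have "(\<lambda>N. T x - T (x - proj N x)) \<longlonglongrightarrow> T x - 0"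
    by (intro tendsto_diff tendsto_const tendsto_norm_zero_cancel[OF T_minus_proj_tendsto])
  then show ?thesis
    by (simp add: blinfun.diff_right)
qed

lemma T_proj: "T (proj N x) = (\<Sum>i<N. cinner (e i) x *\<^sub>C T (e i))"
  by (simp add: proj_def blinfun.sum_right T_scaleC)

text \<open>The series with \<open>u i = T (e i)\<close> is the adjoint: its pairing with
  \<open>y\<close> is the limit of \<open>cinner x (T (proj N y))\<close>, and
  \<open>T (proj N y)\<close> tends to \<open>T y\<close> because \<open>\<sigma>\<close> is
  null.\<close>

lemma adjoint_exists:
  obtains B where "clinear_op B" and "\<And>x y. cinner (B x) y = cinner x (T y)"
    and "\<And>x. (\<lambda>N. \<Sum>i<N. cinner (T (e i)) x *\<^sub>C e i) \<longlonglongrightarrow> B x"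
proof -
  obtain B where B: "clinear_op B" "\<And>x. (\<lambda>N. \<Sum>i<N. cinner (T (e i)) x *\<^sub>C e i) \<longlonglongrightarrow> B x"
    by (rule rank_one_series[of "\<lambda>i. T (e i)", OF T_e_orthogonal eq_refl[OF norm_T_e]
          antimono_sigma sigma_tendsto]) (assumption, rule that)
  have "cinner (B x) y = cinner x (T y)" for x y
  proof (rule LIMSEQ_unique)
    show "(\<lambda>N. cinner (\<Sum>i<N. cinner (T (e i)) x *\<^sub>C e i) y) \<longlonglongrightarrow> cinner (B x) y"
      by (intro cinner.tendsto B tendsto_const)
    have "cinner (\<Sum>i<N. cinner (T (e i)) x *\<^sub>C e i) y = cinner x (T (proj N y))" for N
      unfolding T_proj cinner.sum_left cinner.sum_right
      by (intro sum.cong refl) (metis cinner_commute cinner_scaleC_left cinner_scaleC_right mult.commute)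
    then show "(\<lambda>N. cinner (\<Sum>i<N. cinner (T (e i)) x *\<^sub>C e i) y) \<longlonglongrightarrow> cinner x (T y)"
      by (simp add: cinner.tendsto T_proj_tendsto)
  qed
  with B show ?thesis
    by (intro that)
qed

text \<open>The diagonal operator with entries \<open>\<sigma> i\<close> is positive and has the
  right square, by comparing series. The rest is uniqueness of the positive square root.\<close>

lemma abs_op_series:
  "clinear_op (abs_op T) \<and> (\<forall>x. (\<lambda>N. \<Sum>i<N. (complex_of_real (\<sigma> i) * cinner (e i) x) *\<^sub>C e i) \<longlonglongrightarrow> abs_op T x)"
proof -
  obtain B where B: "clinear_op B" "\<And>x y. cinner (B x) y = cinner x (T y)"
    "\<And>x. (\<lambda>N. \<Sum>i<N. cinner (T (e i)) x *\<^sub>C e i) \<longlonglongrightarrow> B x"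
    using adjoint_exists by blast
  have adj: "adjoint_op T = B"
    by (rule adjoint_op_eq[OF B(1,2)])
  obtain S where S: "clinear_op S"
    "\<And>x. (\<lambda>N. \<Sum>i<N. cinner (complex_of_real (\<sigma> i) *\<^sub>C e i) x *\<^sub>C e i) \<longlonglongrightarrow> S x"
  proof (rule rank_one_series[OF _ _ antimono_sigma sigma_tendsto])
    show "i \<noteq> j \<Longrightarrow> cinner (complex_of_real (\<sigma> i) *\<^sub>C e i) (complex_of_real (\<sigma> j) *\<^sub>C e j) = 0" for i j
      by (simp add: cinner_scaleC_left cinner_scaleC_right cinner_e)
    show "norm (complex_of_real (\<sigma> i) *\<^sub>C e i) \<le> \<sigma> i" for i
      by (simp add: norm_scaleC norm_e sigma_nonneg)
  qed (blast intro: that)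
  then have S: "clinear_op S"
    "\<And>x. (\<lambda>N. \<Sum>i<N. (complex_of_real (\<sigma> i) * cinner (e i) x) *\<^sub>C e i) \<longlonglongrightarrow> S x"
    by (simp_all add: cinner_scaleC_left)
  have e_S: "cinner (e i) (S x) = complex_of_real (\<sigma> i) * cinner (e i) x" for i x
    by (rule cinner_e_series[OF S(2)])
  have "abs_op T = S"
    unfolding abs_op_def adj
  proof (rule the_equality)
    have "cinner x (S x) \<in> \<real>\<^sub>\<ge>\<^sub>0" for x
    proof (rule closed_sequentially)
      show "(\<lambda>N. cinner x (\<Sum>i<N. (complex_of_real (\<sigma> i) * cinner (e i) x) *\<^sub>C e i)) \<longlonglongrightarrow> cinner x (S x)"
        by (intro cinner.tendsto S tendsto_const)
      have "cinner x (\<Sum>i<N. (complex_of_real (\<sigma> i) * cinner (e i) x) *\<^sub>C e i)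
          = complex_of_real (\<Sum>i<N. \<sigma> i * (cmod (cinner (e i) x))\<^sup>2)" for N
        unfolding cinner.sum_right of_real_sum
        by (intro sum.cong refl, subst cinner_scaleC_right, subst cinner_commute[of x])
          (simp add: complex_norm_square mult.assoc del: of_real_power)
      then show "cinner x (\<Sum>i<N. (complex_of_real (\<sigma> i) * cinner (e i) x) *\<^sub>C e i) \<in> \<real>\<^sub>\<ge>\<^sub>0" for N
        by (simp add: sum_nonneg sigma_nonneg del: of_real_sum)
    qed (rule closed_nonneg_Reals_complex)
    then have "positive_op S"
      using S(1) by (simp add: positive_op_def complex_nonneg_Reals_iff complex_is_Real_iff)
    moreover have "S o\<^sub>L S = B o\<^sub>L T"
    proof (rule blinfun_eqI, rule LIMSEQ_unique)
      fix x
      show "(\<lambda>N. \<Sum>i<N. (complex_of_real (\<sigma> i) * cinner (e i) (S x)) *\<^sub>C e i) \<longlonglongrightarrow> (S o\<^sub>L S) x"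
        using S(2) by simp
      show "(\<lambda>N. \<Sum>i<N. (complex_of_real (\<sigma> i) * cinner (e i) (S x)) *\<^sub>C e i) \<longlonglongrightarrow> (B o\<^sub>L T) x"
        using B(3)[of "T x"] by (simp add: cinner_T_e e_S power2_eq_square mult.assoc)
    qed
    ultimately show "positive_op S \<and> S o\<^sub>L S = B o\<^sub>L T" ..
  next
    fix S' assume S': "positive_op S' \<and> S' o\<^sub>L S' = B o\<^sub>L T"
    have lin: "S' (c *\<^sub>C x) = c *\<^sub>C S' x" for c x
      using S' by (simp add: positive_op_def clinear_op_def)
    have sq: "S' (S' x) = B (T x)" for x
      using S' by (metis blinfun_apply_blinfun_compose)
    have norm_S': "norm (S' x) = norm (T x)" for x
    proof -
      have "cinner (S' x) (S' x) = cinner (T x) (T x)"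
        using S' by (metis positive_op_self_adjoint sq B(2) cinner_commute)
      then have "(norm (S' x))\<^sup>2 = (norm (T x))\<^sup>2"
        by (simp only: cinner_self_re[symmetric])
      then show ?thesis
        by (rule power2_eq_imp_eq) simp_all
    qed
    have BTe: "B (T (e i)) = (complex_of_real (\<sigma> i))\<^sup>2 *\<^sub>C e i" for i
    proof (rule cinner_ext)
      fix z
      have "cinner z (B (T (e i))) = cnj (cinner (T (e i)) (T z))"
        by (metis B(2) cinner_commute)
      also have "\<dots> = (complex_of_real (\<sigma> i))\<^sup>2 * cinner z (e i)"
        by (simp add: cinner_T_e cinner_commute[of z])
      finally show "cinner z (B (T (e i))) = cinner z ((complex_of_real (\<sigma> i))\<^sup>2 *\<^sub>C e i)"
        by (simp add: cinner_scaleC_right)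
    qed
    have S'e: "S' (e i) = complex_of_real (\<sigma> i) *\<^sub>C e i" for i
    proof (cases "\<sigma> i = 0")
      case True
      then show ?thesis
        using norm_S'[of "e i"] by (simp add: norm_T_e)
    next
      case False
      then have pos: "\<sigma> i > 0"
        using sigma_nonneg[of i] by simp
      \<comment> \<open>As \<open>S'\<close> squared multiplies \<open>e i\<close> by the square of
        \<open>\<sigma> i\<close>, the vector \<open>z\<close> satisfies the eigenvector equation
        for the negative number \<open>- \<sigma> i\<close>. Positivity of \<open>S'\<close> forces
        it to vanish.\<close>
      define z where "z = S' (e i) - complex_of_real (\<sigma> i) *\<^sub>C e i"
      have "S' z = - complex_of_real (\<sigma> i) *\<^sub>C z"
        by (simp add: z_def blinfun.diff_right lin sq BTe cvec.scale_right_diff_distrib scaleC_scaleC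
            power2_eq_square)
      then have "cinner z (S' z) = - complex_of_real (\<sigma> i * (norm z)\<^sup>2)"
        by (simp add: cinner.minus_right cinner_scaleC_right cinner_self)
      moreover have "Re (cinner z (S' z)) \<ge> 0"
        using S' by (simp add: positive_op_def)
      ultimately have "\<sigma> i * (norm z)\<^sup>2 \<le> 0"
        by (metis Re_complex_of_real neg_0_le_iff_le uminus_complex.sel(1))
      then show ?thesis
        using pos by (simp add: z_def mult_le_0_iff)
    qed
    show "S' = S"
    proof (rule blinfun_eqI, rule LIMSEQ_unique)
      fix x
      have "S' (proj N x) = (\<Sum>i<N. (complex_of_real (\<sigma> i) * cinner (e i) x) *\<^sub>C e i)" for N
        by (simp add: proj_def blinfun.sum_right lin S'e scaleC_scaleC mult.commute)
      then show "(\<lambda>N. S' (proj N x)) \<longlonglongrightarrow> S x"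
        using S(2) by simp
      \<comment> \<open>Since \<open>S' x\<close> and \<open>T x\<close> have equal norms, the decay
        of \<open>T (x - proj N x)\<close> carries over to \<open>S'\<close>, so the values on the
        vectors \<open>e i\<close> determine \<open>S'\<close> even if these are not
        complete.\<close>
      have "(\<lambda>N. S' (proj N x) - S' x) \<longlonglongrightarrow> 0"
        by (rule tendsto_norm_zero_cancel, subst norm_minus_commute)
          (simp add: blinfun.diff_right[symmetric] norm_S' T_minus_proj_tendsto)
      then show "(\<lambda>N. S' (proj N x)) \<longlonglongrightarrow> S' x"
        by (simp add: LIM_zero_iff)
    qed
  qed
  then show ?thesis
    using S by blast
qed

lemma dim_eigenspace_abs_op:
  assumes r: "r > 0"
  shows "cvec.dim (eigenspace (abs_op T) (complex_of_real r)) = card {i. \<sigma> i = r}"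
proof -
  let ?A = "abs_op T" and ?I = "{i. \<sigma> i = r}"
  have lim: "(\<lambda>N. \<Sum>i<N. (complex_of_real (\<sigma> i) * cinner (e i) x) *\<^sub>C e i) \<longlonglongrightarrow> ?A x" for x
    using abs_op_series by blast
  obtain N0 where N0: "\<And>n. n \<ge> N0 \<Longrightarrow> \<sigma> n < r"
    using order_tendstoD(2)[OF sigma_tendsto r] by (auto simp: eventually_sequentially)
  have I: "?I \<subseteq> {..<N}" if "N \<ge> N0" for N
    using N0 that by (metis (mono_tags, lifting) lessThan_iff less_irrefl mem_Collect_eq not_le order_trans subsetI)
  then have fin: "finite ?I"
    using finite_subset by blast
  have A_coeff: "cinner (e i) (?A x) = complex_of_real (\<sigma> i) * cinner (e i) x" for i x
    by (rule cinner_e_series[OF lim])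
  have A_e: "?A (e k) = complex_of_real (\<sigma> k) *\<^sub>C e k" for k
  proof (rule LIMSEQ_unique[OF lim], rule tendsto_eventually, rule eventually_mono[OF eventually_gt_at_top[of k]])
    fix N assume "k < N"
    have "(\<Sum>i<N. (complex_of_real (\<sigma> i) * cinner (e i) (e k)) *\<^sub>C e i)
        = (\<Sum>i<N. if i = k then complex_of_real (\<sigma> i) *\<^sub>C e i else 0)"
      by (intro sum.cong) (auto simp: cinner_e)
    also have "\<dots> = complex_of_real (\<sigma> k) *\<^sub>C e k"
      using \<open>k < N\<close> by (subst sum.delta) auto
    finally show "(\<Sum>i<N. (complex_of_real (\<sigma> i) * cinner (e i) (e k)) *\<^sub>C e i) = complex_of_real (\<sigma> k) *\<^sub>C e k" .
  qed
  have "eigenspace ?A (complex_of_real r) = cvec.span (e ` ?I)"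
  proof (intro equalityI subsetI)
    fix x assume "x \<in> eigenspace ?A (complex_of_real r)"
    then have x: "?A x = complex_of_real r *\<^sub>C x"
      by (simp add: eigenspace_def)
    have "cinner (e i) x = 0" if "\<sigma> i \<noteq> r" for i
      using A_coeff[of i x] that unfolding x by (simp add: cinner_scaleC_right)
    \<comment> \<open>The series represents \<open>?A x\<close>, not \<open>x\<close>. For an
      eigenvector it is finite, and dividing by \<open>r > 0\<close> recovers \<open>x\<close>
      without completeness of \<open>e\<close>.\<close>
    then have "?A x = (\<Sum>i\<in>?I. (complex_of_real (\<sigma> i) * cinner (e i) x) *\<^sub>C e i)"
      using I by (intro LIMSEQ_unique[OF lim tendsto_eventually]
          eventually_mono[OF eventually_ge_at_top[of N0]] sum.mono_neutral_right) auto
    also have "\<dots> \<in> cvec.span (e ` ?I)"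
      by (intro cvec.span_sum cvec.span_scale cvec.span_base) auto
    finally have "complex_of_real (1 / r) *\<^sub>C complex_of_real r *\<^sub>C x \<in> cvec.span (e ` ?I)"
      unfolding x by (rule cvec.span_scale)
    then show "x \<in> cvec.span (e ` ?I)"
      using r by (simp add: scaleC_scaleC flip: of_real_mult)
  next
    have sub: "cvec.subspace (eigenspace ?A (complex_of_real r))"
      using abs_op_series by (simp add: cvec.subspace_def eigenspace_def blinfun.add_right
          scaleC_add_right clinear_op_def scaleC_scaleC mult.commute)
    have "e ` ?I \<subseteq> eigenspace ?A (complex_of_real r)"
      by (auto simp: eigenspace_def A_e)
    from cvec.span_minimal[OF this sub]
    show "x \<in> eigenspace ?A (complex_of_real r)" if "x \<in> cvec.span (e ` ?I)" for x
      using that by blast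
  qed
  moreover have inj: "inj e"
    by (rule injI) (metis cinner_e zero_neq_one)
  moreover have "cvec.independent (e ` ?I)"
  proof (subst cvec.independent_explicit_finite_subsets, intro allI impI ballI)
    fix S u v assume S: "S \<subseteq> e ` ?I" and fS: "finite S" and sum: "(\<Sum>v\<in>S. u v *\<^sub>C v) = 0" and v: "v \<in> S"
    obtain k where k: "v = e k"
      using S v by auto
    have "cinner v (\<Sum>w\<in>S. u w *\<^sub>C w) = (\<Sum>w\<in>S. if w = v then u w else 0)"
      unfolding cinner.sum_right
    proof (intro sum.cong refl)
      fix w assume "w \<in> S"
      then obtain j where "w = e j"
        using S by blast
      then show "cinner v (u w *\<^sub>C w) = (if w = v then u w else 0)"
        by (auto simp: k cinner_scaleC_right cinner_e inj_eq[OF inj])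
    qed
    then show "u v = 0"
      using sum v fS by (simp add: cinner.zero_right)
  qed
  ultimately show ?thesis
    by (simp add: cvec.dim_eq_card_independent card_image inj_on_subset)
qed

text \<open>The shift translates between \<open>\<sigma>\<close>, which starts at 0, and
  \<open>singular_numbers\<close>, which starts at 1 with dummy value 0 in front.\<close>

lemma singular_numbers_eq:
  "singular_numbers T = (\<lambda>n. if n = 0 then 0 else \<sigma> (n - 1))" (is "_ = ?s")
proof -
  have anti: "antimono_on {1..} ?s"
    by (rule monotone_onI) (auto intro!: antimonoD[OF antimono_sigma])
  have "(\<lambda>n. ?s (Suc n)) \<longlonglongrightarrow> 0"
    using sigma_tendsto by simp
  then have lim: "?s \<longlonglongrightarrow> 0"
    by (rule LIMSEQ_imp_Suc)
  have card: "card {n\<in>{1..}. ?s n = r} = cvec.dim (eigenspace (abs_op T) (complex_of_real r))" if "r > 0" for r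
  proof -
    have "{n\<in>{1..}. ?s n = r} = Suc ` {i. \<sigma> i = r}"
      by (auto simp: image_iff) (metis Suc_diff_1 One_nat_def)
    then show ?thesis
      by (simp add: dim_eigenspace_abs_op[OF that] card_image)
  qed
  show ?thesis
    unfolding singular_numbers_def
  proof (rule the_equality)
    fix s assume s: "s 0 = 0 \<and> antimono_on {1..} s \<and> s \<longlonglongrightarrow> 0 \<and>
     (\<forall>r>0. card {n\<in>{1..}. s n = r} = cvec.dim (eigenspace (abs_op T) (complex_of_real r)))"
    show "s = ?s"
    proof
      fix n
      show "s n = ?s n"
      proof (cases "n = 0")
        case False
        then have n: "n \<ge> 1"
          by simp
        have s': "antimono_on {1..} s" "s \<longlonglongrightarrow> 0"
          and card': "\<And>r. r > 0 \<Longrightarrow> card {n\<in>{1..}. s n = r} = card {n\<in>{1..}. ?s n = r}"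
          using s card by simp_all
        have "s n \<le> ?s n"
          by (rule antimono_le_if_level_cards_eq[OF s' anti lim card' n])
        moreover have "?s n \<le> s n"
          by (rule antimono_le_if_level_cards_eq[OF anti lim s' card'[symmetric] n])
        ultimately show ?thesis
          by (rule antisym)
      qed (use s in simp)
    qed
  qed (use anti lim card in auto)
qed

end

subsection \<open>Gelfand numbers\<close>

text \<open>Gaussian elimination, by induction on the set of equations.\<close>

lemma homogeneous_system_nontrivial_solution:
  fixes a :: "'i \<Rightarrow> 'k \<Rightarrow> 'f::field"
  assumes "finite I" "finite K" "card I < card K"
  shows "\<exists>c. (\<exists>k\<in>K. c k \<noteq> 0) \<and> (\<forall>i\<in>I. (\<Sum>k\<in>K. c k * a i k) = 0)"
  using assms
proof (induction I arbitrary: K a rule: finite_induct)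
  case empty
  then obtain k where "k \<in> K"
    by fastforce
  then show ?case
    by (intro exI[of _ "\<lambda>_. 1"]) auto
next
  case (insert i I)
  show ?case
  proof (cases "\<forall>k\<in>K. a i k = 0")
    case True
    have "card I < card K"
      using insert.prems insert.hyps by simp
    from insert.IH[OF insert.prems(1) this, of a] True show ?thesis
      by auto
  next
    case False
    then obtain j where j: "j \<in> K" "a i j \<noteq> 0"
      by blast
    have "card I < card (K - {j})"
      using insert.prems insert.hyps j(1) by simp
    \<comment> \<open>The coefficients that remain after equation \<open>i\<close> has been used to
      eliminate the unknown \<open>j\<close>.\<close>
    from insert.IH[OF finite_Diff[OF insert.prems(1)] this, of "\<lambda>l k. a l k - a l j * a i k / a i j"]
    obtain c where c: "\<exists>k\<in>K - {j}. c k \<noteq> 0"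
      and sum0: "\<And>l. l \<in> I \<Longrightarrow> (\<Sum>k\<in>K - {j}. c k * (a l k - a l j * a i k / a i j)) = 0"
      by blast
    \<comment> \<open>The eliminated unknown is restored by solving equation \<open>i\<close> for
      it.\<close>
    define d where "d = c(j := - (\<Sum>k\<in>K - {j}. c k * a i k) / a i j)"
    have sum_d: "(\<Sum>k\<in>K. d k * a l k) = (\<Sum>k\<in>K - {j}. c k * (a l k - a l j * a i k / a i j))" for l
    proof -
      have "(\<Sum>k\<in>K. d k * a l k) = d j * a l j + (\<Sum>k\<in>K - {j}. c k * a l k)"
        unfolding sum.remove[OF insert.prems(1) j(1)] by (simp add: d_def)
      also have "d j * a l j = - (\<Sum>k\<in>K - {j}. c k * (a l j * a i k / a i j))"
        by (simp add: d_def sum_distrib_left sum_distrib_right sum_divide_distrib mult_ac)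
      finally show ?thesis
        by (simp add: sum_subtractf algebra_simps)
    qed
    show ?thesis
    proof (intro exI[of _ d] conjI ballI)
      show "\<exists>k\<in>K. d k \<noteq> 0"
        using c by (auto simp: d_def)
      show "(\<Sum>k\<in>K. d k * a l k) = 0" if "l \<in> insert i I" for l
      proof (cases "l = i")
        case True
        then show ?thesis
          using j unfolding sum_d by simp
      next
        case False
        then show ?thesis
          using sum0 that unfolding sum_d by simp
      qed
    qed
  qed
qed

text \<open>Functionals in the algebraic sense: finite sets of them serve to cut out subspaces of
  finite codimension.\<close>

definition clinear_functional :: "('a::complex_vector \<Rightarrow> complex) \<Rightarrow> bool" where
  "clinear_functional \<phi> \<longleftrightarrow> (\<forall>x y. \<phi> (x + y) = \<phi> x + \<phi> y) \<and> (\<forall>c x. \<phi> (c *\<^sub>C x) = c * \<phi> x)"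

lemma clinear_functional_sum:
  assumes "clinear_functional \<phi>"
  shows "\<phi> (\<Sum>i\<in>I. c i *\<^sub>C v i) = (\<Sum>i\<in>I. c i * \<phi> (v i))"
proof -
  have "\<phi> 0 = 0"
    using assms by (metis clinear_functional_def cvec.scale_zero_left mult_zero_left)
  then show ?thesis
    using assms by (induction I rule: infinite_finite_induct) (simp_all add: clinear_functional_def)
qed

text \<open>This bounds the \<open>(n + 1)\<close>-st Gelfand number of \<open>A\<close>, which for a compact operator is its
  \<open>(n + 1)\<close>-st singular number.\<close>

definition gelfand_le :: "('a::complex_hilbert \<Rightarrow>\<^sub>L 'a) \<Rightarrow> nat \<Rightarrow> real \<Rightarrow> bool" where
  "gelfand_le A n b \<longleftrightarrow> (\<exists>\<Phi>. finite \<Phi> \<and> card \<Phi> \<le> n \<and> (\<forall>\<phi>\<in>\<Phi>. clinear_functional \<phi>) \<and>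
     (\<forall>x. (\<forall>\<phi>\<in>\<Phi>. \<phi> x = 0) \<longrightarrow> norm (A x) \<le> b * norm x))"

lemma gelfand_leE:
  assumes "gelfand_le A n b"
  obtains \<Phi> where "finite \<Phi>" "card \<Phi> \<le> n" "\<And>\<phi>. \<phi> \<in> \<Phi> \<Longrightarrow> clinear_functional \<phi>"
    "\<And>x. \<forall>\<phi>\<in>\<Phi>. \<phi> x = 0 \<Longrightarrow> norm (A x) \<le> b * norm x"
  using assms unfolding gelfand_le_def by blast

lemma gelfand_le_mono:
  assumes "gelfand_le A m b" "m \<le> n" "b \<le> c"
  shows "gelfand_le A n c"
proof -
  obtain \<Phi> where \<Phi>: "finite \<Phi>" "card \<Phi> \<le> m" "\<And>\<phi>. \<phi> \<in> \<Phi> \<Longrightarrow> clinear_functional \<phi>"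
    "\<And>x. \<forall>\<phi>\<in>\<Phi>. \<phi> x = 0 \<Longrightarrow> norm (A x) \<le> b * norm x"
    by (rule gelfand_leE[OF assms(1)]) (rule that)
  have "norm (A x) \<le> c * norm x" if "\<forall>\<phi>\<in>\<Phi>. \<phi> x = 0" for x
    using \<Phi>(4)[of x] that mult_right_mono[OF \<open>b \<le> c\<close> norm_ge_zero[of x]] by (meson order_trans)
  then show ?thesis
    unfolding gelfand_le_def using \<Phi>(1-3) \<open>m \<le> n\<close> by (intro exI[of _ \<Phi>]) auto
qed

lemma gelfand_le_zero: "gelfand_le 0 0 0"
  unfolding gelfand_le_def by (intro exI[of _ "{}"]) simp

text \<open>The additive Ky Fan inequality: imposing both sets of conditions makes both estimates
  available.\<close>

lemma gelfand_le_add: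
  assumes "gelfand_le A m b" "gelfand_le B n c"
  shows "gelfand_le (A + B) (m + n) (b + c)"
proof -
  obtain \<Phi> where \<Phi>: "finite \<Phi>" "card \<Phi> \<le> m" "\<And>\<phi>. \<phi> \<in> \<Phi> \<Longrightarrow> clinear_functional \<phi>"
    "\<And>x. \<forall>\<phi>\<in>\<Phi>. \<phi> x = 0 \<Longrightarrow> norm (A x) \<le> b * norm x"
    by (rule gelfand_leE[OF assms(1)]) (rule that)
  obtain \<Psi> where \<Psi>: "finite \<Psi>" "card \<Psi> \<le> n" "\<And>\<phi>. \<phi> \<in> \<Psi> \<Longrightarrow> clinear_functional \<phi>"
    "\<And>x. \<forall>\<phi>\<in>\<Psi>. \<phi> x = 0 \<Longrightarrow> norm (B x) \<le> c * norm x"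
    by (rule gelfand_leE[OF assms(2)]) (rule that)
  have "norm ((A + B) x) \<le> (b + c) * norm x" if "\<forall>\<phi>\<in>\<Phi> \<union> \<Psi>. \<phi> x = 0" for x
  proof -
    have "norm (A x + B x) \<le> norm (A x) + norm (B x)"
      by (rule norm_triangle_ineq)
    also have "\<dots> \<le> b * norm x + c * norm x"
      using that by (intro add_mono \<Phi>(4) \<Psi>(4)) simp_all
    finally show ?thesis
      by (simp add: blinfun.add_left distrib_right)
  qed
  moreover have "card (\<Phi> \<union> \<Psi>) \<le> m + n"
    using card_Un_le[of \<Phi> \<Psi>] \<Phi>(2) \<Psi>(2) by linarith
  ultimately show ?thesis
    unfolding gelfand_le_def using \<Phi>(1,3) \<Psi>(1,3) by (intro exI[of _ "\<Phi> \<union> \<Psi>"]) auto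
qed

lemma gelfand_le_scaleC:
  assumes "gelfand_le A n b"
  shows "gelfand_le (c *\<^sub>C A) n (cmod c * b)"
proof -
  obtain \<Phi> where \<Phi>: "finite \<Phi>" "card \<Phi> \<le> n" "\<And>\<phi>. \<phi> \<in> \<Phi> \<Longrightarrow> clinear_functional \<phi>"
    "\<And>x. \<forall>\<phi>\<in>\<Phi>. \<phi> x = 0 \<Longrightarrow> norm (A x) \<le> b * norm x"
    by (rule gelfand_leE[OF assms]) (rule that)
  have "norm ((c *\<^sub>C A) x) \<le> cmod c * b * norm x" if "\<forall>\<phi>\<in>\<Phi>. \<phi> x = 0" for x
    using mult_left_mono[OF \<Phi>(4)[OF that] norm_ge_zero[of c]]
    by (simp add: scaleC_blinfun.rep_eq norm_scaleC mult.assoc)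
  then show ?thesis
    unfolding gelfand_le_def using \<Phi>(1-3) by (intro exI[of _ \<Phi>]) auto
qed

text \<open>The multiplicative Ky Fan inequality: the conditions for \<open>A\<close> are pulled
  back along \<open>B\<close> and joined with those for \<open>B\<close>.\<close>

lemma gelfand_le_compose:
  assumes "clinear_op B" and "gelfand_le A m b" and "gelfand_le B n c" and "b \<ge> 0"
  shows "gelfand_le (A o\<^sub>L B) (m + n) (b * c)"
proof -
  obtain \<Phi> where \<Phi>: "finite \<Phi>" "card \<Phi> \<le> m" "\<And>\<phi>. \<phi> \<in> \<Phi> \<Longrightarrow> clinear_functional \<phi>"
    "\<And>x. \<forall>\<phi>\<in>\<Phi>. \<phi> x = 0 \<Longrightarrow> norm (A x) \<le> b * norm x"
    by (rule gelfand_leE[OF assms(2)]) (rule that)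
  obtain \<Psi> where \<Psi>: "finite \<Psi>" "card \<Psi> \<le> n" "\<And>\<phi>. \<phi> \<in> \<Psi> \<Longrightarrow> clinear_functional \<phi>"
    "\<And>x. \<forall>\<phi>\<in>\<Psi>. \<phi> x = 0 \<Longrightarrow> norm (B x) \<le> c * norm x"
    by (rule gelfand_leE[OF assms(3)]) (rule that)
  let ?\<Phi> = "(\<lambda>\<phi> x. \<phi> (B x)) ` \<Phi>"
  have "norm ((A o\<^sub>L B) x) \<le> b * c * norm x" if "\<forall>\<phi>\<in>?\<Phi> \<union> \<Psi>. \<phi> x = 0" for x
  proof -
    have "norm (A (B x)) \<le> b * norm (B x)"
      using that by (intro \<Phi>(4)) auto
    also have "\<dots> \<le> b * (c * norm x)"
      using that by (intro mult_left_mono \<Psi>(4) \<open>b \<ge> 0\<close>) auto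
    finally show ?thesis
      by (simp add: mult.assoc)
  qed
  moreover have "card (?\<Phi> \<union> \<Psi>) \<le> m + n"
    using card_Un_le[of ?\<Phi> \<Psi>] card_image_le[OF \<Phi>(1), of "\<lambda>\<phi> x. \<phi> (B x)"] \<Phi>(2) \<Psi>(2) by linarith
  moreover have "clinear_functional (\<lambda>x. \<phi> (B x))" if "\<phi> \<in> \<Phi>" for \<phi>
    using \<Phi>(3)[OF that] assms(1) by (simp add: clinear_functional_def clinear_op_def blinfun.add_right)
  ultimately show ?thesis
    unfolding gelfand_le_def using \<Phi>(1,3) \<Psi>(1,3) by (intro exI[of _ "?\<Phi> \<union> \<Psi>"]) auto
qed

lemma gelfand_le_norm: "gelfand_le A 0 (norm A)"
  unfolding gelfand_le_def by (intro exI[of _ "{}"]) (simp add: norm_blinfun)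

section \<open>Singular numbers as Gelfand numbers\<close>

context schmidt
begin

lemma gelfand_le_sigma: "gelfand_le T n (\<sigma> n)"
  unfolding gelfand_le_def
proof (intro exI[of _ "(\<lambda>i. cinner (e i)) ` {..<n}"] conjI ballI allI impI)
  show "card ((\<lambda>i. cinner (e i)) ` {..<n}) \<le> n"
    using card_image_le[of "{..<n}"] by fastforce
  show "norm (T x) \<le> \<sigma> n * norm x" if "\<forall>\<phi>\<in>(\<lambda>i. cinner (e i)) ` {..<n}. \<phi> x = 0" for x
    using that by (intro norm_T_le) auto
qed (auto simp: clinear_functional_def cinner_add_right cinner_scaleC_right)

text \<open>At most \<open>n\<close> linear conditions have a nonzero solution in the span of the
  \<open>n + 1\<close> vectors \<open>e 0\<close> to \<open>e n\<close>, and on that span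
  \<open>T\<close> stretches norms by at least \<open>\<sigma> n\<close>.\<close>

lemma sigma_le_gelfand:
  assumes "gelfand_le T n b"
  shows "\<sigma> n \<le> b"
proof -
  obtain \<Phi> where \<Phi>: "finite \<Phi>" "card \<Phi> \<le> n" "\<And>\<phi>. \<phi> \<in> \<Phi> \<Longrightarrow> clinear_functional \<phi>"
    "\<And>x. \<forall>\<phi>\<in>\<Phi>. \<phi> x = 0 \<Longrightarrow> norm (T x) \<le> b * norm x"
    by (rule gelfand_leE[OF assms]) (rule that)
  have "card \<Phi> < card {..n}"
    using \<Phi>(2) by simp
  from homogeneous_system_nontrivial_solution[OF \<Phi>(1) finite_atMost this, of "\<lambda>\<phi> k. \<phi> (e k)"]
  obtain c where c: "\<exists>k\<in>{..n}. c k \<noteq> 0" and sum0: "\<And>\<phi>. \<phi> \<in> \<Phi> \<Longrightarrow> (\<Sum>k\<le>n. c k * \<phi> (e k)) = 0"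
    by blast
  define x where "x = (\<Sum>k\<le>n. c k *\<^sub>C e k)"
  have Tx: "T x = (\<Sum>k\<le>n. c k *\<^sub>C T (e k))"
    by (simp add: x_def blinfun.sum_right T_scaleC)
  have nx: "(norm x)\<^sup>2 = (\<Sum>k\<le>n. (cmod (c k))\<^sup>2)"
  proof -
    have "(norm x)\<^sup>2 = (\<Sum>k\<le>n. (norm (c k *\<^sub>C e k))\<^sup>2)"
      unfolding x_def by (intro norm_sum_sq_orthogonal)
        (simp_all add: cinner_scaleC_left cinner_scaleC_right cinner_e)
    then show ?thesis
      by (simp add: norm_scaleC norm_e)
  qed
  have "(\<sigma> n)\<^sup>2 * (norm x)\<^sup>2 = (\<Sum>k\<le>n. (\<sigma> n)\<^sup>2 * (cmod (c k))\<^sup>2)"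
    by (simp add: nx sum_distrib_left)
  also have "\<dots> \<le> (\<Sum>k\<le>n. (norm (c k *\<^sub>C T (e k)))\<^sup>2)"
  proof (rule sum_mono)
    fix k assume "k \<in> {..n}"
    then have "\<sigma> n \<le> \<sigma> k"
      by (intro antimonoD[OF antimono_sigma]) simp
    then have "(\<sigma> n)\<^sup>2 * (cmod (c k))\<^sup>2 \<le> (\<sigma> k)\<^sup>2 * (cmod (c k))\<^sup>2"
      by (intro mult_right_mono power_mono sigma_nonneg) simp_all
    then show "(\<sigma> n)\<^sup>2 * (cmod (c k))\<^sup>2 \<le> (norm (c k *\<^sub>C T (e k)))\<^sup>2"
      by (simp add: norm_scaleC norm_T_e power_mult_distrib mult.commute)
  qed
  also have "\<dots> = (norm (T x))\<^sup>2"
    unfolding Tx by (intro norm_sum_sq_orthogonal[symmetric])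
      (simp_all add: cinner_scaleC_left cinner_scaleC_right T_e_orthogonal)
  finally have "\<sigma> n * norm x \<le> norm (T x)"
    by (intro power2_le_imp_le[OF _ norm_ge_zero]) (simp only: power_mult_distrib)
  also have "norm (T x) \<le> b * norm x"
    using sum0 by (intro \<Phi>(4)) (simp add: x_def clinear_functional_sum \<Phi>(3))
  finally have le: "\<sigma> n * norm x \<le> b * norm x" .
  obtain k where k: "k \<le> n" "c k \<noteq> 0"
    using c by auto
  have "0 < (cmod (c k))\<^sup>2"
    using k(2) by simp
  also have "\<dots> \<le> (norm x)\<^sup>2"
    unfolding nx using k(1) by (intro member_le_sum) auto
  finally have "norm x > 0"
    by simp
  then show ?thesis
    using le by simp
qed

end

subsection \<open>Lie ideals from operator ideals\<close>

text \<open>This is the intersection of \<open>L\<close> with an operator ideal; the factor \<open>k\<close> is the ampliation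
  needed for closure under addition.\<close>

definition dominated :: "('a::complex_hilbert \<Rightarrow>\<^sub>L 'a) set \<Rightarrow> (nat \<Rightarrow> real) \<Rightarrow> ('a \<Rightarrow>\<^sub>L 'a) set" where
  "dominated L \<tau> = {A\<in>L. \<exists>C\<ge>0. \<exists>k. \<forall>n. gelfand_le A (k * n) (C * \<tau> n)}"

lemma dominatedI:
  assumes "A \<in> L" "C \<ge> 0" "\<And>n. gelfand_le A (k * n) (C * \<tau> n)"
  shows "A \<in> dominated L \<tau>"
  using assms unfolding dominated_def by blast

lemma dominatedE:
  assumes "A \<in> dominated L \<tau>"
  obtains C k where "A \<in> L" "C \<ge> 0" "\<And>n. gelfand_le A (k * n) (C * \<tau> n)"
  using assms unfolding dominated_def by blast

text \<open>For sums, both the constants and the ampliation factors add. Composition with a member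
  of \<open>L\<close> costs a factor \<open>norm A\<close> and no further conditions.\<close>

lemma lie_ideal_dominated:
  assumes L: "lie_algebra_compact L" and \<tau>: "\<And>n. \<tau> n \<ge> 0"
  shows "lie_ideal (dominated L \<tau>) L"
proof -
  have sub: "cvec.subspace L" and comm: "\<And>A B. A \<in> L \<Longrightarrow> B \<in> L \<Longrightarrow> commutator A B \<in> L"
    and clin: "\<And>A. A \<in> L \<Longrightarrow> clinear_op A"
    using L by (auto simp: lie_algebra_compact_def lie_algebra_def compact_op_def)
  have zero: "0 \<in> dominated L \<tau>"
    using gelfand_le_zero by (intro dominatedI[where C = 0 and k = 0] cvec.subspace_0[OF sub]) simp_all
  have add: "A + B \<in> dominated L \<tau>" if AB: "A \<in> dominated L \<tau>" "B \<in> dominated L \<tau>" for A B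
  proof -
    obtain C k where A: "A \<in> L" "C \<ge> 0" "\<And>n. gelfand_le A (k * n) (C * \<tau> n)"
      by (rule dominatedE[OF AB(1)]) (rule that)
    obtain D l where B: "B \<in> L" "D \<ge> 0" "\<And>n. gelfand_le B (l * n) (D * \<tau> n)"
      by (rule dominatedE[OF AB(2)]) (rule that)
    have "gelfand_le (A + B) ((k + l) * n) ((C + D) * \<tau> n)" for n
      using gelfand_le_add[OF A(3) B(3), of n n] by (simp add: distrib_right)
    then show ?thesis
      by (rule dominatedI[OF cvec.subspace_add[OF sub A(1) B(1)] add_nonneg_nonneg[OF A(2) B(2)]])
  qed
  have scale: "c *\<^sub>C A \<in> dominated L \<tau>" if A: "A \<in> dominated L \<tau>" for A c
  proof -
    obtain C k where *: "A \<in> L" "C \<ge> 0" "\<And>n. gelfand_le A (k * n) (C * \<tau> n)"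
      by (rule dominatedE[OF A]) (rule that)
    have "gelfand_le (c *\<^sub>C A) (k * n) ((cmod c * C) * \<tau> n)" for n
      using gelfand_le_scaleC[OF *(3), of c n] by (simp add: mult.assoc)
    then show ?thesis
      by (rule dominatedI[OF cvec.subspace_scale[OF sub *(1)] mult_nonneg_nonneg[OF norm_ge_zero *(2)]])
  qed
  have comm_dom: "commutator A B \<in> dominated L \<tau>" if A: "A \<in> L" and B: "B \<in> dominated L \<tau>" for A B
  proof -
    obtain C k where *: "B \<in> L" "C \<ge> 0" "\<And>n. gelfand_le B (k * n) (C * \<tau> n)"
      by (rule dominatedE[OF B]) (rule that)
    have "gelfand_le (commutator A B) ((k + k) * n) ((2 * norm A * C) * \<tau> n)" for n
    proof -
      have 1: "gelfand_le (A o\<^sub>L B) (0 + k * n) (norm A * (C * \<tau> n))"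
        by (rule gelfand_le_compose[OF clin[OF *(1)] gelfand_le_norm *(3) norm_ge_zero])
      have "gelfand_le (B o\<^sub>L A) (k * n + 0) (C * \<tau> n * norm A)"
        by (rule gelfand_le_compose[OF clin[OF A] *(3) gelfand_le_norm]) (simp add: *(2) \<tau>)
      from gelfand_le_scaleC[OF this, of "-1"]
      have 2: "gelfand_le (- (B o\<^sub>L A)) (k * n + 0) (C * \<tau> n * norm A)"
        by simp
      show ?thesis
        using gelfand_le_add[OF 1 2] by (simp add: commutator_def algebra_simps)
    qed
    then show ?thesis
      by (rule dominatedI[OF comm[OF A *(1)], rotated]) (simp add: *(2))
  qed
  have "dominated L \<tau> \<subseteq> L"
    by (auto simp: dominated_def)
  moreover have "cvec.subspace (dominated L \<tau>)"
    by (simp add: cvec.subspace_def zero add scale)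
  ultimately show ?thesis
    using comm_dom by (simp add: lie_ideal_def lie_algebra_def subset_iff)
qed

text \<open>Each of the two products satisfies a bound by a multiple of the square of
  \<open>\<tau> n\<close> at index \<open>(k + l) * n\<close>; adding them doubles index and
  constant.\<close>

lemma commutator_mem_dominated_square:
  assumes L: "lie_algebra_compact L" and \<tau>: "\<And>n. \<tau> n \<ge> 0"
    and A: "A \<in> dominated L \<tau>" and B: "B \<in> dominated L \<tau>"
  shows "commutator A B \<in> dominated L (\<lambda>n. (\<tau> n)\<^sup>2)"
proof -
  obtain C k where *: "A \<in> L" "C \<ge> 0" "\<And>n. gelfand_le A (k * n) (C * \<tau> n)"
    by (rule dominatedE[OF A]) (rule that)
  obtain D l where **: "B \<in> L" "D \<ge> 0" "\<And>n. gelfand_le B (l * n) (D * \<tau> n)"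
    by (rule dominatedE[OF B]) (rule that)
  have clin: "clinear_op A" "clinear_op B" and mem: "commutator A B \<in> L"
    using L *(1) **(1) by (auto simp: lie_algebra_compact_def lie_algebra_def compact_op_def)
  have "gelfand_le (commutator A B) ((2 * (k + l)) * n) ((2 * C * D) * (\<tau> n)\<^sup>2)" for n
  proof -
    have 1: "gelfand_le (A o\<^sub>L B) (k * n + l * n) (C * \<tau> n * (D * \<tau> n))"
      by (rule gelfand_le_compose[OF clin(2) *(3) **(3)]) (simp add: *(2) \<tau>)
    have "gelfand_le (B o\<^sub>L A) (l * n + k * n) (D * \<tau> n * (C * \<tau> n))"
      by (rule gelfand_le_compose[OF clin(1) **(3) *(3)]) (simp add: **(2) \<tau>)
    from gelfand_le_scaleC[OF this, of "-1"]
    have 2: "gelfand_le (- (B o\<^sub>L A)) (l * n + k * n) (D * \<tau> n * (C * \<tau> n))"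
      by simp
    have "gelfand_le (commutator A B) (k * n + l * n + (l * n + k * n))
        (C * \<tau> n * (D * \<tau> n) + D * \<tau> n * (C * \<tau> n))"
      using gelfand_le_add[OF 1 2] by (simp add: commutator_def)
    then show ?thesis
      by (rule gelfand_le_mono) (simp_all add: algebra_simps power2_eq_square)
  qed
  then show ?thesis
    by (rule dominatedI[OF mem, rotated]) (simp add: *(2) **(2))
qed

section \<open>The \<Delta>2-condition and the contradiction to simplicity\<close>

lemma Delta2_power:
  assumes "Delta2 \<xi>"
  obtains M where "M > 0" and "\<And>j n. n \<ge> 1 \<Longrightarrow> \<xi> n \<le> M ^ j * \<xi> (2 ^ j * n)"
proof -
  have pos: "\<And>n. n \<ge> 1 \<Longrightarrow> 0 < \<xi> n"
    using assms by (simp add: Delta2_def)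
  obtain M where M: "\<And>n. n \<ge> 1 \<Longrightarrow> \<xi> n / \<xi> (2 * n) \<le> M"
    using assms unfolding Delta2_def bdd_above_def by auto
  have M0: "M > 0"
    using M[of 1] divide_pos_pos[OF pos[of 1] pos[of "2 * 1"]] by linarith
  have step: "\<xi> n \<le> M * \<xi> (2 * n)" if "n \<ge> 1" for n
    using M[OF that] pos[of "2 * n"] that by (simp add: pos_divide_le_eq)
  have "\<xi> n \<le> M ^ j * \<xi> (2 ^ j * n)" if "n \<ge> 1" for j n
  proof (induction j)
    case (Suc j)
    have "\<xi> (2 ^ j * n) \<le> M * \<xi> (2 * (2 ^ j * n))"
      using that by (intro step) simp
    then have "M ^ j * \<xi> (2 ^ j * n) \<le> M ^ j * (M * \<xi> (2 * (2 ^ j * n)))"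
      using M0 by (intro mult_left_mono) simp_all
    then show ?case
      using Suc by (simp add: mult_ac)
  qed simp
  then show ?thesis
    using M0 that by blast
qed

lemma not_lie_simple_if_Delta2:
  fixes L :: "('a::complex_hilbert \<Rightarrow>\<^sub>L 'a) set"
  assumes inf: "infinite_cdim (UNIV :: 'a set)"
    and L: "lie_algebra_compact L" and nonab: "nonabelian L"
    and T: "T \<in> L" and D2: "Delta2 (singular_numbers T)"
  shows "\<not> lie_simple L"
proof
  assume simple: "lie_simple L"
  have compT: "compact_op T"
    using L T by (simp add: lie_algebra_compact_def)
  obtain e where "schmidt e T (\<lambda>n. norm (T (e n)))"
    using schmidt_exists[OF compT inf] .
  define \<sigma> where "\<sigma> n = norm (T (e n))" for n
  interpret schmidt e T \<sigma>
    unfolding \<sigma>_def by fact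
  have sing: "singular_numbers T (Suc n) = \<sigma> n" for n
    by (simp add: singular_numbers_eq)
  have "singular_numbers T (Suc n) > 0" for n
    using D2 by (simp add: Delta2_def)
  then have pos: "\<sigma> n > 0" for n
    by (simp add: sing)
  have "T \<in> dominated L \<sigma>"
    by (rule dominatedI[OF T, of 1 1]) (simp_all add: gelfand_le_sigma)
  moreover have "T \<noteq> 0"
    using pos[of 0] norm_T_e[of 0] by auto
  moreover have "lie_ideal (dominated L \<sigma>) L"
    by (rule lie_ideal_dominated[OF L]) (rule sigma_nonneg)
  then have "dominated L \<sigma> = {0} \<or> dominated L \<sigma> = L"
    using simple by (simp add: lie_simple_def)
  ultimately have dom: "dominated L \<sigma> = L"
    by auto
  obtain A B where AB: "A \<in> L" "B \<in> L" "commutator A B \<noteq> 0"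
    using nonab unfolding nonabelian_def by blast
  have "commutator A B \<in> dominated L (\<lambda>n. (\<sigma> n)\<^sup>2)"
    using AB(1,2) by (intro commutator_mem_dominated_square[OF L]) (simp_all add: dom sigma_nonneg)
  moreover have "lie_ideal (dominated L (\<lambda>n. (\<sigma> n)\<^sup>2)) L"
    by (rule lie_ideal_dominated[OF L]) simp
  then have "dominated L (\<lambda>n. (\<sigma> n)\<^sup>2) = {0} \<or> dominated L (\<lambda>n. (\<sigma> n)\<^sup>2) = L"
    using simple by (simp add: lie_simple_def)
  ultimately have "dominated L (\<lambda>n. (\<sigma> n)\<^sup>2) = L"
    using AB(3) by auto
  then have "T \<in> dominated L (\<lambda>n. (\<sigma> n)\<^sup>2)"
    using T by simp
  then obtain C k where k: "\<And>n. gelfand_le T (k * n) (C * (\<sigma> n)\<^sup>2)"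
    by (rule dominatedE) (rule that)
  obtain M where M: "M > 0" "\<And>j n. n \<ge> 1 \<Longrightarrow> singular_numbers T n \<le> M ^ j * singular_numbers T (2 ^ j * n)"
    by (rule Delta2_power[OF D2]) (rule that)
  \<comment> \<open>Doubling the index \<open>k\<close> times multiplies it by
    \<open>2 ^ k \<ge> k\<close>, which reaches beyond the ampliation \<open>k * n\<close> at the
    cost of a factor \<open>M ^ k\<close>.\<close>
  have "1 \<le> M ^ k * C * \<sigma> n" for n
  proof -
    have "k * n + 1 \<le> 2 ^ k * (n + 1)"
    proof -
      have "k \<le> 2 ^ k"
        by (rule less_imp_le[OF less_exp])
      then have "k * n + 1 \<le> 2 ^ k * n + 2 ^ k"
        by (intro add_mono mult_right_mono) simp_all
      then show ?thesis
        by simp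
    qed
    \<comment> \<open>The subtraction of 1 comes from the index shift between
      \<open>singular_numbers T\<close> and \<open>\<sigma>\<close>.\<close>
    then have le: "k * n \<le> 2 ^ k * Suc n - 1"
      by simp
    have "\<sigma> n \<le> M ^ k * singular_numbers T (2 ^ k * Suc n)"
      using M(2)[of "Suc n" k] by (simp add: sing)
    also have "singular_numbers T (2 ^ k * Suc n) = \<sigma> (2 ^ k * Suc n - 1)"
      using sing[of "2 ^ k * Suc n - 1"] by simp
    also have "\<dots> \<le> \<sigma> (k * n)"
      by (rule antimonoD[OF antimono_sigma le])
    also have "\<dots> \<le> C * (\<sigma> n)\<^sup>2"
      by (rule sigma_le_gelfand[OF k])
    finally have "\<sigma> n * 1 \<le> \<sigma> n * (M ^ k * C * \<sigma> n)"
      using M(1) by (simp add: power2_eq_square mult_ac)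
    then show ?thesis
      using pos[of n] by (simp only: mult_le_cancel_left_pos)
  qed
  moreover have "(\<lambda>n. M ^ k * C * \<sigma> n) \<longlonglongrightarrow> 0"
    using tendsto_mult_left[OF sigma_tendsto, of "M ^ k * C"] by simp
  ultimately have "(1::real) \<le> 0"
    by (intro LIMSEQ_le_const[of _ 0]) auto
  then show False
    by simp
qed

subsection \<open>Weighted shifts\<close>

definition tail_space :: "(nat \<Rightarrow> 'a::complex_hilbert) \<Rightarrow> nat \<Rightarrow> 'a set" where
  "tail_space e n = {x. \<forall>k\<in>{1..n}. cinner (e k) x = 0}"

lemma subspace_tail_space: "cvec.subspace (tail_space e n)"
  by (auto simp: tail_space_def cvec.subspace_def cinner.zero_right cinner_add_right cinner_scaleC_right)

text \<open>For an orthonormal basis these are the operators whose matrix is supported at least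
  \<open>d\<close> places below the diagonal. The condition by subspaces makes degrees add under
  composition.\<close>

definition lowering :: "(nat \<Rightarrow> 'a::complex_hilbert) \<Rightarrow> nat \<Rightarrow> ('a \<Rightarrow>\<^sub>L 'a) set" where
  "lowering e d = {A. clinear_op A \<and> (\<forall>n. blinfun_apply A ` tail_space e n \<subseteq> tail_space e (n + d))}"

lemma lowering_mono: "lowering e (Suc d) \<subseteq> lowering e d"
  by (fastforce simp: lowering_def tail_space_def)

lemma subspace_lowering: "cvec.subspace (lowering e d)"
  unfolding cvec.subspace_def lowering_def
  by (auto simp: clinear_op_def blinfun.add_left scaleC_blinfun.rep_eq scaleC_add_right scaleC_scaleC
      mult.commute image_subset_iff
      intro!: cvec.subspace_0[OF subspace_tail_space] cvec.subspace_add[OF subspace_tail_space]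
        cvec.subspace_scale[OF subspace_tail_space])

lemma lowering_compose:
  assumes "A \<in> lowering e c" "B \<in> lowering e d"
  shows "A o\<^sub>L B \<in> lowering e (d + c)"
proof -
  have "A (B x) \<in> tail_space e (n + (d + c))" if "x \<in> tail_space e n" for x n
  proof -
    have "B x \<in> tail_space e (n + d)"
      using assms(2) that unfolding lowering_def by blast
    then have "A (B x) \<in> tail_space e (n + d + c)"
      using assms(1) unfolding lowering_def by blast
    then show ?thesis
      by (simp add: add.assoc)
  qed
  then show ?thesis
    using assms by (auto simp: lowering_def clinear_op_def)
qed

lemma commutator_lowering:
  assumes "A \<in> lowering e c" "B \<in> lowering e d"
  shows "commutator A B \<in> lowering e (c + d)"
  unfolding commutator_def
  using lowering_compose[OF assms] lowering_compose[OF assms(2,1)]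
  by (intro cvec.subspace_diff[OF subspace_lowering]) (simp_all add: add.commute)

text \<open>The coefficient of \<open>T x\<close> at \<open>e k\<close> is \<open>w (k - 1)\<close>
  times that of \<open>x\<close> at \<open>e (k - 1)\<close>. This holds on basis vectors, hence on
  their span, and by continuity everywhere.\<close>

lemma weighted_shift_lowering:
  fixes e :: "nat \<Rightarrow> 'a::complex_hilbert"
  assumes e: "orthonormal_basis e" and T: "weighted_shift e T"
  shows "T \<in> lowering e 1"
proof -
  have orth: "\<And>m n. m \<ge> 1 \<Longrightarrow> n \<ge> 1 \<Longrightarrow> cinner (e m) (e n) = (if m = n then 1 else 0)"
    and dense: "closure (cvec.span (e ` {1..})) = UNIV"
    using e by (auto simp: orthonormal_basis_def)
  have clin: "clinear_op T"
    using T by (simp add: weighted_shift_def)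
  obtain w where w: "\<And>n. n \<ge> 1 \<Longrightarrow> T (e n) = w n *\<^sub>C e (n + 1)"
    using T unfolding weighted_shift_def by blast
  have "cinner (e k) (T x) = 0" if x: "x \<in> tail_space e n" and k: "k \<in> {1..n + 1}" for x n k
  proof -
    \<comment> \<open>The value 0 for \<open>k = 1\<close> expresses that no basis vector is sent to
      a multiple of \<open>e 1\<close>, and keeps the meaningless index 0 out.\<close>
    define a where "a = (if k = 1 then 0 else w (k - 1))"
    define u where "u = (if k = 1 then 0 else e (k - 1))"
    let ?S = "{x. cinner (e k) (T x) = a * cinner u x}"
    have "cvec.subspace ?S"
      using clin by (auto simp: cvec.subspace_def cinner.zero_right cinner_add_right cinner_scaleC_right
          blinfun.add_right clinear_op_def distrib_left)
    moreover have "e ` {1..} \<subseteq> ?S"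
    proof (rule image_subsetI, rule CollectI)
      fix m :: nat assume m: "m \<in> {1..}"
      show "cinner (e k) (T (e m)) = a * cinner u (e m)"
        using m k by (cases "k = 1") (auto simp: w cinner_scaleC_right orth a_def u_def cinner.zero_left
            split: if_splits)
    qed
    ultimately have "cvec.span (e ` {1..}) \<subseteq> ?S"
      by (intro cvec.span_minimal)
    moreover have "closed ?S"
      by (intro closed_Collect_eq cinner.continuous_on continuous_on_mult continuous_on_const
          blinfun.continuous_on continuous_on_id)
    ultimately have "x \<in> ?S"
      using closure_minimal dense by blast
    moreover have "cinner u x = 0"
    proof (cases "k = 1")
      case False
      then have "k - 1 \<in> {1..n}"
        using k by auto
      then show ?thesis
        using x False by (simp add: u_def tail_space_def)
    qed (simp add: u_def cinner.zero_left)
    ultimately show ?thesis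
      by simp
  qed
  then show ?thesis
    using clin by (auto simp: lowering_def tail_space_def)
qed

text \<open>The unit ball is mapped into the multiples of \<open>v\<close> by scalars from a closed
  disc, a compact set.\<close>

lemma compact_op_rank_one: "compact_op (rank_one u v)"
proof -
  have "compact ((\<lambda>c. c *\<^sub>C v) ` cball 0 (norm u))"
    by (intro compact_continuous_image compact_cball linear_continuous_on
        bounded_bilinear.bounded_linear_left[OF bounded_bilinear_scaleC])
  moreover have "blinfun_apply (rank_one u v) ` cball 0 1 \<subseteq> (\<lambda>c. c *\<^sub>C v) ` cball 0 (norm u)"
  proof (rule image_subsetI)
    fix x :: 'a assume "x \<in> cball 0 1"
    then have "cmod (cinner u x) \<le> norm u"
      using cmod_cinner_le[of u x] mult_left_mono[of "norm x" 1 "norm u"] by simp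
    then show "rank_one u v x \<in> (\<lambda>c. c *\<^sub>C v) ` cball 0 (norm u)"
      by (intro image_eqI[of _ _ "cinner u x"]) (simp_all add: rank_one.rep_eq)
  qed
  ultimately have "compact (closure (blinfun_apply (rank_one u v) ` cball 0 1))"
    by (metis closed_closure closure_minimal compact_Int_closed compact_imp_closed inf.absorb2)
  then show ?thesis
    by (simp add: compact_op_def clinear_op_rank_one)
qed

lemma not_lie_simple_weighted_shift:
  fixes e :: "nat \<Rightarrow> 'a::complex_hilbert"
  assumes e: "orthonormal_basis e"
  shows "\<not> lie_simple (weighted_shift_lie_algebra e)"
proof
  let ?L = "weighted_shift_lie_algebra e"
  assume simple: "lie_simple ?L"
  have orth: "\<And>m n. m \<ge> 1 \<Longrightarrow> n \<ge> 1 \<Longrightarrow> cinner (e m) (e n) = (if m = n then 1 else 0)"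
    using e by (auto simp: orthonormal_basis_def)
  have sub: "cvec.subspace ?L" and comm: "\<And>A B. A \<in> ?L \<Longrightarrow> B \<in> ?L \<Longrightarrow> commutator A B \<in> ?L"
    by (auto simp: weighted_shift_lie_algebra_def lie_generated_def lie_algebra_def cvec.subspace_def)
  \<comment> \<open>A Lie algebra containing the generators, so it contains all of
    \<open>?L\<close>.\<close>
  have "lie_algebra (lowering e 1)"
    using commutator_lowering[of _ e 1 _ 1] lowering_mono[of e 1] subspace_lowering
    unfolding lie_algebra_def by (fastforce simp: numeral_2_eq_2)
  then have L_lower: "?L \<subseteq> lowering e 1"
    unfolding weighted_shift_lie_algebra_def lie_generated_def
    using weighted_shift_lowering[OF e] by blast
  define J where "J = ?L \<inter> lowering e 2"
  have comm_J: "commutator A B \<in> J" if "A \<in> ?L" "B \<in> ?L" for A B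
    using commutator_lowering[of A e 1 B 1] comm[OF that] that L_lower by (auto simp: J_def numeral_2_eq_2)
  have "cvec.subspace J"
    unfolding J_def by (intro cvec.subspace_inter sub subspace_lowering)
  then have "lie_ideal J ?L"
    using comm_J by (auto simp: lie_ideal_def lie_algebra_def J_def)
  then consider "J = {0}" | "J = ?L"
    using simple unfolding lie_simple_def by blast
  then show False
  proof cases
    \<comment> \<open>Matrix units just below the diagonal. The commutator of \<open>S 2\<close> and
      \<open>S 1\<close> sends \<open>e 1\<close> to \<open>e 3\<close>, so \<open>J\<close> is
      nonzero; \<open>S 1\<close> itself moves \<open>e 1\<close> only one place, so
      \<open>J\<close> is proper.\<close>
    define S where "S n = rank_one (e n) (e (Suc n))" for n
    have S_e: "S n (e m) = (if n = m then e (Suc n) else 0)" if "n \<ge> 1" "m \<ge> 1" for n m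
      using that by (simp add: S_def rank_one.rep_eq orth)
    have "weighted_shift e (S n)" if "n \<ge> 1" for n
      unfolding weighted_shift_def
    proof (intro conjI exI[of _ "\<lambda>m. if n = m then 1 else 0"] allI impI)
      show "clinear_op (S n)"
        by (simp add: S_def clinear_op_rank_one)
      show "S n (e m) = (if n = m then 1 else 0) *\<^sub>C e (m + 1)" if "m \<ge> 1" for m
        using S_e[OF \<open>n \<ge> 1\<close> that] by simp
    qed
    then have S_L: "S n \<in> ?L" if "n \<ge> 1" for n
      using that compact_op_rank_one unfolding weighted_shift_lie_algebra_def lie_generated_def S_def by blast
    {
      case 1
      have "commutator (S 2) (S 1) (e 1) = e 3"
        by (simp add: commutator_def blinfun.diff_left S_e blinfun.zero_right numeral_3_eq_3 numeral_2_eq_2)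
      moreover have "commutator (S 2) (S 1) = 0"
        using comm_J[OF S_L S_L, of 2 1] 1 by simp
      ultimately have "cinner (e 3) (e 3) = 0"
        by (metis blinfun.zero_left cinner.zero_left)
      then show False
        by (simp add: orth)
    next
      case 2
      have "S 1 \<in> lowering e 2"
        using S_L[of 1] 2 by (auto simp: J_def)
      \<comment> \<open>\<open>tail_space e 0\<close> imposes no condition and thus contains
        \<open>e 1\<close>.\<close>
      then have "S 1 (e 1) \<in> tail_space e (0 + 2)"
        unfolding lowering_def by (force simp: tail_space_def)
      then have "cinner (e 2) (e 2) = 0"
        by (simp add: S_e tail_space_def numeral_2_eq_2)
      then show False
        by (simp add: orth)
    }
  qed
qed

theorem corollary3p8:
  assumes "separable_space (euclidean :: 'h::complex_hilbert topology)"
    and "infinite_cdim (UNIV :: 'h set)"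
  shows "(\<forall>L :: ('h \<Rightarrow>\<^sub>L 'h) set.
            lie_algebra_compact L \<and> infinite_cdim L \<and> nonabelian L \<and>
            (\<forall>A\<in>L. quasinilpotent_op A) \<and>
            (\<exists>T\<in>L. Delta2 (singular_numbers T))
            \<longrightarrow> \<not> lie_simple L) \<and>
         (\<forall>e :: nat \<Rightarrow> 'h. orthonormal_basis e \<longrightarrow>
            \<not> lie_simple (weighted_shift_lie_algebra e))"
  using not_lie_simple_if_Delta2[OF assms(2)] not_lie_simple_weighted_shift by blast

end
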